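(* Let $X$ be a Banach space and $C\subset X$ a non-empty, closed, convex and bounded set, and let $\mathcal{M}$ be the space of nonexpansive mappings $F:C\to\mathcal{K}(C)$ with the metric $\rho$ of uniform convergence. For every $x_0\in C$ there is a residual subset $\mathcal{F}\subset\mathcal{M}$ such that every $F\in\mathcal{F}$ admits a regular trajectory starting with $x_0$, which converges to a fixed point of $F$ (that is, to a point $x\in C$ with $x\in F(x)$).
   Context: $\mathcal{K}(C)$ is the set of non-empty compact subsets of $C$ with the Pompeiu-Hausdorff distance $H(A,B)=\max\{\sup_{a\in A}\inf_{b\in B}\|a-b\|,\ \sup_{b\in B}\inf_{a\in A}\|a-b\|\}$. A mapping $F:C\to\mathcal{K}(C)$ is nonexpansive if $H(F(x),F(y))\le\|x-y\|$ for all $x,y\in C$. $\mathcal{M}$ denotes the set of all such mappings, with the complete metric $\rho(F,G)=\sup_{x\in C}H(F(x),G(x))$. For $M\subset X$ and $x\in X$, $P_M(x)=\{y\in M:\|x-y\|=\inf_{w\in M}\|x-w\|\}$. A trajectory (sequence of successive approximations) with respect to $F$ starting at $x_0$ is a sequence $(x_n)_{n=0}^\infty$ in $C$ with $x_{n+1}\in P_{F(x_n)}(x_n)$ for all $n$; it is called regular if $P_{F(x_n)}(x_n)$ is a singleton for all $n\ge 0$. A set is meagre if it is a countable union of nowhere dense sets; a residual set is the complement of a meagre set. *)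

theory Defs
  imports "HOL-Analysis.Analysis"
begin

definition nonempty_compacts :: "'a::metric_space set \<Rightarrow> 'a set set" where
  "nonempty_compacts C = {A. A \<subseteq> C \<and> A \<noteq> {} \<and> compact A}"

definition hausdist :: "'a::metric_space set \<Rightarrow> 'a set \<Rightarrow> real" where
  "hausdist A B = max (SUP a\<in>A. infdist a B) (SUP b\<in>B. infdist b A)"

text \<open>
  Mappings \<open>C \<rightarrow> nonempty_compacts C\<close> are represented extensionally (with the value
  \<^const>\<open>undefined\<close> off \<open>C\<close>), so that two of them are equal iff they agree on \<open>C\<close>.
\<close>

definition nonexpansive_maps :: "'a::metric_space set \<Rightarrow> ('a \<Rightarrow> 'a set) set" where
  "nonexpansive_maps C =
     {F \<in> C \<rightarrow>\<^sub>E nonempty_compacts C. \<forall>x\<in>C. \<forall>y\<in>C. hausdist (F x) (F y) \<le> dist x y}"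

text \<open>
  The value 0 off the carrier is a mere totalisation: \<^locale>\<open>Metric_space\<close> asks for
  nonnegativity and symmetry of the distance function on the whole type.
\<close>

definition unif_dist :: "'a::metric_space set \<Rightarrow> ('a \<Rightarrow> 'a set) \<Rightarrow> ('a \<Rightarrow> 'a set) \<Rightarrow> real" where
  "unif_dist C F G =
     (if F \<in> nonexpansive_maps C \<and> G \<in> nonexpansive_maps C
      then SUP x\<in>C. hausdist (F x) (G x) else 0)"

definition nonexpansive_topology :: "'a::metric_space set \<Rightarrow> ('a \<Rightarrow> 'a set) topology" where
  "nonexpansive_topology C = Metric_space.mtopology (nonexpansive_maps C) (unif_dist C)"

definition metric_proj :: "'a::metric_space set \<Rightarrow> 'a \<Rightarrow> 'a set" where
  "metric_proj M x = {y \<in> M. dist x y = infdist x M}"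

definition is_trajectory ::
    "'a::metric_space set \<Rightarrow> ('a \<Rightarrow> 'a set) \<Rightarrow> 'a \<Rightarrow> (nat \<Rightarrow> 'a) \<Rightarrow> bool" where
  "is_trajectory C F x0 x \<longleftrightarrow>
     x 0 = x0 \<and> (\<forall>n. x n \<in> C) \<and> (\<forall>n. x (Suc n) \<in> metric_proj (F (x n)) (x n))"

definition is_regular_trajectory ::
    "'a::metric_space set \<Rightarrow> ('a \<Rightarrow> 'a set) \<Rightarrow> 'a \<Rightarrow> (nat \<Rightarrow> 'a) \<Rightarrow> bool" where
  "is_regular_trajectory C F x0 x \<longleftrightarrow>
     is_trajectory C F x0 x \<and> (\<forall>n. is_singleton (metric_proj (F (x n)) (x n)))"

definition nowhere_dense_in :: "'a topology \<Rightarrow> 'a set \<Rightarrow> bool" where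
  "nowhere_dense_in T S \<longleftrightarrow> S \<subseteq> topspace T \<and> T interior_of (T closure_of S) = {}"

definition meagre_in :: "'a topology \<Rightarrow> 'a set \<Rightarrow> bool" where
  "meagre_in T S \<longleftrightarrow> (\<exists>\<N>. countable \<N> \<and> (\<forall>N\<in>\<N>. nowhere_dense_in T N) \<and> S = \<Union>\<N>)"

definition residual_in :: "'a topology \<Rightarrow> 'a set \<Rightarrow> bool" where
  "residual_in T S \<longleftrightarrow> S \<subseteq> topspace T \<and> meagre_in T (topspace T - S)"


lemma bdd_above_infdist:
  assumes "compact A"
  shows "bdd_above ((\<lambda>a. infdist a B) ` A)"
  by (intro bounded_imp_bdd_above compact_imp_bounded compact_continuous_image
      continuous_on_infdist continuous_on_id assms)

lemma infdist_le_hausdist: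
  assumes "compact A" "a \<in> A"
  shows "infdist a B \<le> hausdist A B"
  using cSUP_upper[OF assms(2) bdd_above_infdist[OF assms(1), of B]]
  by (simp add: hausdist_def)

lemma hausdist_commute: "hausdist A B = hausdist B A"
  by (simp add: hausdist_def max.commute)

lemma hausdist_le:
  assumes "A \<noteq> {}" "B \<noteq> {}"
    and "\<And>a. a \<in> A \<Longrightarrow> infdist a B \<le> r" "\<And>b. b \<in> B \<Longrightarrow> infdist b A \<le> r"
  shows "hausdist A B \<le> r"
  unfolding hausdist_def by (intro max.boundedI cSUP_least assms)

lemma hausdist_nonneg:
  assumes "compact A" "A \<noteq> {}"
  shows "0 \<le> hausdist A B"
proof -
  obtain a where "a \<in> A" using assms by blast
  then show ?thesis
    using infdist_le_hausdist[OF assms(1), of a B] infdist_nonneg[of a B] by linarith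
qed

lemma hausdist_refl: "compact A \<Longrightarrow> A \<noteq> {} \<Longrightarrow> hausdist A A = 0"
  by (intro antisym hausdist_nonneg hausdist_le) auto

lemma hausdist_zero_imp_subset:
  assumes "compact A" "compact B" "B \<noteq> {}" "hausdist A B = 0"
  shows "A \<subseteq> B"
proof
  fix a assume "a \<in> A"
  then have "infdist a B = 0"
    using infdist_le_hausdist[OF assms(1), of a B] infdist_nonneg[of a B] assms(4) by linarith
  then show "a \<in> B"
    using in_closed_iff_infdist_zero[OF compact_imp_closed[OF assms(2)] assms(3)] by blast
qed

lemma hausdist_triangle:
  assumes A: "compact A" "A \<noteq> {}" and B: "compact B" "B \<noteq> {}" and D: "compact D" "D \<noteq> {}"
  shows "hausdist A D \<le> hausdist A B + hausdist B D"
proof -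
  have *: "infdist a D \<le> hausdist A B + hausdist B D"
    if "a \<in> A" "compact A" "compact B" "B \<noteq> {}" for a and A B D :: "'a set"
  proof -
    have "infdist a D - hausdist B D \<le> dist a b" if "b \<in> B" for b
      using infdist_triangle[of a D b] infdist_le_hausdist[OF \<open>compact B\<close> that, of D] by linarith
    then have "infdist a D - hausdist B D \<le> infdist a B"
      unfolding infdist_notempty[OF \<open>B \<noteq> {}\<close>] by (intro cINF_greatest \<open>B \<noteq> {}\<close>)
    then show ?thesis
      using infdist_le_hausdist[OF \<open>compact A\<close> \<open>a \<in> A\<close>, of B] by linarith
  qed
  show ?thesis
    using *[of _ A B D] *[of _ D B A] assms
    by (intro hausdist_le) (auto simp: hausdist_commute add.commute)
qed

lemma nonexpansive_mapsD:
  assumes "F \<in> nonexpansive_maps C" "x \<in> C"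
  shows "compact (F x)" "F x \<noteq> {}" "F x \<subseteq> C"
  using assms by (auto simp: nonexpansive_maps_def nonempty_compacts_def PiE_iff)

lemma bdd_above_hausdist:
  assumes "bounded C" "F \<in> nonexpansive_maps C" "G \<in> nonexpansive_maps C"
  shows "bdd_above ((\<lambda>x. hausdist (F x) (G x)) ` C)"
proof (rule bdd_aboveI2)
  fix x assume "x \<in> C"
  note F = nonexpansive_mapsD[OF assms(2) this] and G = nonexpansive_mapsD[OF assms(3) this]
  have *: "infdist a B \<le> diameter C" if "a \<in> C" "B \<noteq> {}" "B \<subseteq> C" for a B
  proof -
    obtain b where "b \<in> B" using \<open>B \<noteq> {}\<close> by blast
    then show ?thesis
      using infdist_le[of b B a] diameter_bounded_bound[OF assms(1), of a b] that by fastforce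
  qed
  show "hausdist (F x) (G x) \<le> diameter C"
    using F G by (intro hausdist_le *) auto
qed

text \<open>The carrier and distance behind \<^const>\<open>nonexpansive_topology\<close> do form a metric space.\<close>

lemma Metric_space_nonexpansive_maps:
  assumes "bounded C" "C \<noteq> {}"
  shows "Metric_space (nonexpansive_maps C) (unif_dist C)"
proof
  have up: "hausdist (F x) (G x) \<le> unif_dist C F G"
    if "F \<in> nonexpansive_maps C" "G \<in> nonexpansive_maps C" "x \<in> C" for F G x
    using cSUP_upper[OF that(3) bdd_above_hausdist[OF assms(1) that(1,2)]] that
    by (simp add: unif_dist_def)
  show "0 \<le> unif_dist C F G" for F G
  proof (cases "F \<in> nonexpansive_maps C \<and> G \<in> nonexpansive_maps C")
    case True
    obtain x where x: "x \<in> C" using assms by blast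
    have "0 \<le> hausdist (F x) (G x)"
      using True x by (intro hausdist_nonneg nonexpansive_mapsD) auto
    then show ?thesis using up[of F G x] True x by linarith
  qed (auto simp: unif_dist_def)
  show "unif_dist C F G = unif_dist C G F" for F G
    by (auto simp: unif_dist_def hausdist_commute)
  show "unif_dist C F G = 0 \<longleftrightarrow> F = G"
    if FG: "F \<in> nonexpansive_maps C" "G \<in> nonexpansive_maps C" for F G
  proof
    assume 0: "unif_dist C F G = 0"
    show "F = G"
    proof (rule PiE_ext)
      show "F \<in> C \<rightarrow>\<^sub>E nonempty_compacts C" "G \<in> C \<rightarrow>\<^sub>E nonempty_compacts C"
        using FG by (auto simp: nonexpansive_maps_def)
      fix x assume x: "x \<in> C"
      note F = nonexpansive_mapsD[OF FG(1) x] and G = nonexpansive_mapsD[OF FG(2) x]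
      have "hausdist (F x) (G x) = 0"
        using up[OF FG x] 0 hausdist_nonneg[OF F(1,2), of "G x"] by linarith
      then show "F x = G x"
        using hausdist_zero_imp_subset F G by (metis hausdist_commute subset_antisym)
    qed
  next
    assume "F = G"
    then have "hausdist (F x) (G x) = 0" if "x \<in> C" for x
      using hausdist_refl nonexpansive_mapsD[OF FG(1) that] by blast
    then show "unif_dist C F G = 0"
      using assms FG by (simp add: unif_dist_def)
  qed
  show "unif_dist C F H \<le> unif_dist C F G + unif_dist C G H"
    if FGH: "F \<in> nonexpansive_maps C" "G \<in> nonexpansive_maps C" "H \<in> nonexpansive_maps C"
    for F G H
  proof -
    have "hausdist (F x) (H x) \<le> unif_dist C F G + unif_dist C G H" if "x \<in> C" for x
      using hausdist_triangle[of "F x" "G x" "H x"] up[of F G x] up[of G H x]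
        nonexpansive_mapsD[OF FGH(1) that] nonexpansive_mapsD[OF FGH(2) that]
        nonexpansive_mapsD[OF FGH(3) that] FGH that by fastforce
    then have "(SUP x\<in>C. hausdist (F x) (H x)) \<le> unif_dist C F G + unif_dist C G H"
      by (rule cSUP_least[OF assms(2)])
    then show ?thesis
      using FGH by (simp add: unif_dist_def)
  qed
qed

lemma topspace_nonexpansive_topology:
  assumes "bounded C" "C \<noteq> {}"
  shows "topspace (nonexpansive_topology C) = nonexpansive_maps C"
  unfolding nonexpansive_topology_def
  by (rule Metric_space.topspace_mtopology[OF Metric_space_nonexpansive_maps[OF assms]])

end

theory Submission
  imports Defs
begin

text \<open>
  By a Baire argument it suffices that near every nonexpansive \<open>F\<close> there is a map \<open>G\<close> such that, for
  all maps close enough to \<open>G\<close>, every trajectory from \<open>x0\<close> is determined up to \<open>r\<close> at each step and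
  finally stays in a set of diameter at most \<open>r\<close>. For a contraction \<open>G\<close> the steps of a trajectory
  decrease geometrically, but a small perturbation may drift along a continuum of fixed points. The
  drift is impossible near a fixed point \<open>c\<close> that is isolated in \<open>G c\<close>: then a small ball about \<open>c\<close>
  traps all trajectories of all maps close to \<open>G\<close>. So the heart of the matter is to approximate \<open>F\<close>
  by a contraction with finite values on a set containing the trajectories.

  After a homothety towards \<open>x0\<close>, \<open>F\<close> is a contraction and leaves a compact convex set \<open>K\<close>
  containing \<open>x0\<close> invariant. Composing it with a multivalued almost nonexpansive map that is close to
  the identity and sends a neighbourhood of \<open>K\<close> into \<open>K\<close>, one may assume that \<open>F\<close> maps this
  neighbourhood into \<open>K\<close>. On \<open>K\<close> the value \<open>F x\<close> is then replaced by finitely many tokens on segments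
  between points of a finite net of \<open>K\<close>. A token moves only when \<open>F x\<close> forces it to, and at slightly
  more than the speed of \<open>F x\<close>, so it can pursue \<open>F x\<close> with a bounded lag. Finally, ties among nearest
  points are broken for as many steps as it takes to enter a trap.
\<close>

section \<open>Multivalued Lipschitz maps\<close>

definition covered_within :: "real \<Rightarrow> 'a::metric_space set \<Rightarrow> 'a set \<Rightarrow> bool" where
  "covered_within r A B \<longleftrightarrow> (\<forall>a\<in>A. \<exists>b\<in>B. dist a b \<le> r)"

text \<open>As \<open>x\<close> and \<open>y\<close> range over all pairs, one-sided covering
  already is the Hausdorff bound.\<close>

definition set_lipschitz :: "real \<Rightarrow> 'a::metric_space set \<Rightarrow> ('a \<Rightarrow> 'a set) \<Rightarrow> bool" where
  "set_lipschitz k C F \<longleftrightarrow> (\<forall>x\<in>C. F x \<in> nonempty_compacts C) \<and>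
     (\<forall>x\<in>C. \<forall>y\<in>C. covered_within (k * dist x y) (F x) (F y))"

definition set_close :: "real \<Rightarrow> 'a::metric_space set \<Rightarrow> ('a \<Rightarrow> 'a set) \<Rightarrow> ('a \<Rightarrow> 'a set) \<Rightarrow> bool" where
  "set_close r C F G \<longleftrightarrow> (\<forall>x\<in>C. covered_within r (F x) (G x) \<and> covered_within r (G x) (F x))"

lemma covered_withinI: "(\<And>a. a \<in> A \<Longrightarrow> \<exists>b\<in>B. dist a b \<le> r) \<Longrightarrow> covered_within r A B"
  by (simp add: covered_within_def)

lemma covered_withinE:
  assumes "covered_within r A B" "a \<in> A"
  obtains b where "b \<in> B" "dist a b \<le> r"
  using assms by (auto simp: covered_within_def)

lemma covered_within_mono: "covered_within r A B \<Longrightarrow> r \<le> s \<Longrightarrow> covered_within s A B"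
  unfolding covered_within_def by (meson order_trans)

lemma covered_within_trans:
  assumes "covered_within r A B" "covered_within s B D"
  shows "covered_within (r + s) A D"
proof (rule covered_withinI)
  fix a assume "a \<in> A"
  then obtain b where b: "b \<in> B" "dist a b \<le> r" using assms(1) by (elim covered_withinE)
  then obtain d where "d \<in> D" "dist b d \<le> s" using assms(2) by (elim covered_withinE)
  then show "\<exists>d\<in>D. dist a d \<le> r + s" using b dist_triangle[of a d b] by force
qed

lemma compact_infdist_attained:
  assumes "compact B" "B \<noteq> {}"
  obtains b where "b \<in> B" "infdist x B = dist x b"
proof -
  obtain b where b: "b \<in> B" "\<forall>y\<in>B. dist x b \<le> dist x y"
    using continuous_attains_inf[OF assms, of "dist x"] continuous_on_dist[OF continuous_on_const continuous_on_id]
    by blast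
  have "infdist x B = dist x b"
    using b assms(2)
    by (intro antisym infdist_le) (auto simp: infdist_notempty intro!: cINF_greatest)
  with b(1) show thesis using that by blast
qed

text \<open>Compactness makes the infima attained, so later estimates can argue with witnesses
  instead of suprema and infima.\<close>

lemma hausdist_le_iff:
  assumes "compact A" "A \<noteq> {}" "compact B" "B \<noteq> {}"
  shows "hausdist A B \<le> r \<longleftrightarrow> covered_within r A B \<and> covered_within r B A"
proof (intro iffI conjI covered_withinI)
  fix a assume r: "hausdist A B \<le> r" and a: "a \<in> A"
  obtain b where "b \<in> B" "infdist a B = dist a b"
    using compact_infdist_attained assms(3,4) by blast
  then show "\<exists>b\<in>B. dist a b \<le> r" using infdist_le_hausdist[OF assms(1) a, of B] r by force
next
  fix b assume r: "hausdist A B \<le> r" and b: "b \<in> B"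
  obtain a where "a \<in> A" "infdist b A = dist b a"
    using compact_infdist_attained assms(1,2) by blast
  then show "\<exists>a\<in>A. dist b a \<le> r"
    using infdist_le_hausdist[OF assms(3) b, of A] r hausdist_commute[of A B] by force
next
  assume "covered_within r A B \<and> covered_within r B A"
  then show "hausdist A B \<le> r"
    using assms(2,4) unfolding covered_within_def by (intro hausdist_le) (meson infdist_le2)+
qed

lemma infdist_covered_within:
  assumes "covered_within r A B" "A \<noteq> {}"
  shows "infdist x B \<le> infdist x A + r"
proof -
  have "infdist x B - r \<le> dist x a" if "a \<in> A" for a
  proof -
    obtain b where "b \<in> B" "dist a b \<le> r"
      using assms(1) \<open>a \<in> A\<close> unfolding covered_within_def by blast
    then show ?thesis using infdist_le[of b B x] dist_triangle[of x b a] by linarith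
  qed
  then have "infdist x B - r \<le> infdist x A"
    unfolding infdist_notempty[OF assms(2)] by (intro cINF_greatest assms(2))
  then show ?thesis by linarith
qed

lemma set_lipschitzD:
  assumes "set_lipschitz k C F" "x \<in> C"
  shows "compact (F x)" "F x \<noteq> {}" "F x \<subseteq> C"
    and "y \<in> C \<Longrightarrow> covered_within (k * dist x y) (F x) (F y)"
  using assms unfolding set_lipschitz_def nonempty_compacts_def by blast+

lemma set_lipschitzI:
  assumes "\<And>x. x \<in> C \<Longrightarrow> compact (F x)" "\<And>x. x \<in> C \<Longrightarrow> F x \<noteq> {}" "\<And>x. x \<in> C \<Longrightarrow> F x \<subseteq> C"
    and "\<And>x y a. \<lbrakk>x \<in> C; y \<in> C; a \<in> F x\<rbrakk> \<Longrightarrow> \<exists>b\<in>F y. dist a b \<le> k * dist x y"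
  shows "set_lipschitz k C F"
  using assms unfolding set_lipschitz_def nonempty_compacts_def covered_within_def by blast

lemma set_lipschitz_mono:
  assumes "set_lipschitz k C F" "k \<le> l"
  shows "set_lipschitz l C F"
  using assms(1) covered_within_mono[OF _ mult_right_mono[OF assms(2) zero_le_dist]]
  unfolding set_lipschitz_def by blast

lemma nonexpansive_imp_set_lipschitz:
  assumes "F \<in> nonexpansive_maps C"
  shows "set_lipschitz 1 C F"
proof -
  have "covered_within (dist x y) (F x) (F y)" if "x \<in> C" "y \<in> C" for x y
    using hausdist_le_iff[OF nonexpansive_mapsD(1,2)[OF assms that(1)]
        nonexpansive_mapsD(1,2)[OF assms that(2)], of "dist x y"] assms that
    by (simp add: nonexpansive_maps_def)
  then show ?thesis
    using nonexpansive_mapsD[OF assms] unfolding set_lipschitz_def nonempty_compacts_def by simp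
qed

lemma set_lipschitz_imp_nonexpansive:
  assumes "set_lipschitz k C F" "k \<le> 1"
  shows "restrict F C \<in> nonexpansive_maps C"
proof -
  note F = set_lipschitzD[OF set_lipschitz_mono[OF assms]]
  have "hausdist (F x) (F y) \<le> dist x y" if "x \<in> C" "y \<in> C" for x y
    using F(4)[OF that] F(4)[OF that(2,1)] F(1,2)[OF that(1)] F(1,2)[OF that(2)]
    by (simp add: hausdist_le_iff dist_commute)
  then show ?thesis using F by (simp add: nonexpansive_maps_def nonempty_compacts_def)
qed

section \<open>Closeness of maps and the uniform metric\<close>

lemma set_close_trans:
  assumes "set_close r C F G" "set_close s C G H"
  shows "set_close (r + s) C F H"
  unfolding set_close_def
proof (intro ballI conjI)
  fix x assume "x \<in> C"
  then have *: "covered_within r (F x) (G x)" "covered_within r (G x) (F x)"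
    "covered_within s (G x) (H x)" "covered_within s (H x) (G x)"
    using assms by (auto simp: set_close_def)
  show "covered_within (r + s) (F x) (H x)" using covered_within_trans[OF *(1,3)] .
  show "covered_within (r + s) (H x) (F x)"
    using covered_within_trans[OF *(4,2)] by (simp add: add.commute)
qed

lemma set_close_mono: "set_close r C F G \<Longrightarrow> r \<le> s \<Longrightarrow> set_close s C F G"
  by (auto simp: set_close_def intro: covered_within_mono)

lemma unif_dist_le_iff:
  assumes "bounded C" "C \<noteq> {}" "F \<in> nonexpansive_maps C" "G \<in> nonexpansive_maps C"
  shows "unif_dist C F G \<le> r \<longleftrightarrow> set_close r C F G"
proof -
  have "unif_dist C F G \<le> r \<longleftrightarrow> (\<forall>x\<in>C. hausdist (F x) (G x) \<le> r)"
    using assms by (simp add: unif_dist_def cSUP_le_iff bdd_above_hausdist)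
  also have "\<dots> \<longleftrightarrow> set_close r C F G"
    unfolding set_close_def
    by (intro ball_cong refl hausdist_le_iff nonexpansive_mapsD[OF assms(3)]
        nonexpansive_mapsD[OF assms(4)])
  finally show ?thesis .
qed

text \<open>Two extractions: the parameters converge to some \<open>l\<close>; then the points have
  companions in the single compact set \<open>F l\<close>, which converge along a further
  subsequence. The Lipschitz bound gives both sequences the same limit.\<close>

lemma compact_UN_set_lipschitz:
  assumes F: "set_lipschitz k C F" and T: "compact T" "T \<subseteq> C"
  shows "compact (\<Union>t\<in>T. F t)"
  unfolding compact_def
proof safe
  fix f :: "nat \<Rightarrow> 'a" assume "\<forall>n. f n \<in> (\<Union>t\<in>T. F t)"
  then obtain t where t: "\<And>n. t n \<in> T" "\<And>n. f n \<in> F (t n)" by (simp add: Bex_def) metis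
  obtain l r where l: "l \<in> T" "strict_mono (r :: nat \<Rightarrow> nat)" "(t \<circ> r) \<longlonglongrightarrow> l"
    using T(1) t(1) unfolding compact_def by blast
  have "\<exists>b\<in>F l. dist (f (r n)) b \<le> k * dist (t (r n)) l" for n
    using set_lipschitzD(4)[OF F, of "t (r n)" l] t l T(2)
    by (meson covered_withinE subsetD)
  then obtain b where b: "\<And>n. b n \<in> F l" "\<And>n. dist (f (r n)) (b n) \<le> k * dist (t (r n)) l"
    by metis
  have "compact (F l)" using set_lipschitzD(1)[OF F] l T by blast
  then obtain m q where m: "m \<in> F l" "strict_mono (q :: nat \<Rightarrow> nat)" "(b \<circ> q) \<longlonglongrightarrow> m"
    using b(1) unfolding compact_def by blast
  have tl: "(\<lambda>n. t (r (q n))) \<longlonglongrightarrow> l"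
    using LIMSEQ_subseq_LIMSEQ[OF l(3) m(2)] by (simp add: o_def)
  have "(\<lambda>n. k * dist (t (r (q n))) l + dist (b (q n)) m) \<longlonglongrightarrow> k * dist l l + dist m m"
    using m(3) tl by (intro tendsto_intros) (simp_all add: o_def)
  then have 0: "(\<lambda>n. k * dist (t (r (q n))) l + dist (b (q n)) m) \<longlonglongrightarrow> 0" by simp
  have "(\<lambda>n. f (r (q n))) \<longlonglongrightarrow> m"
  proof (rule metric_tendsto_imp_tendsto[OF 0] , rule always_eventually, intro allI)
    fix n
    show "dist (f (r (q n))) m \<le> dist (k * dist (t (r (q n))) l + dist (b (q n)) m) 0"
      using b(2)[of "q n"] dist_triangle[of "f (r (q n))" m "b (q n)"]
      by (simp add: dist_real_def)
  qed
  then show "\<exists>l\<in>\<Union>t\<in>T. F t. \<exists>r. strict_mono r \<and> (f \<circ> r) \<longlonglongrightarrow> l"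
    using l m by (intro bexI[of _ m] exI[of _ "r \<circ> q"]) (auto simp: o_def strict_mono_def)
qed

lemma set_lipschitz_compose:
  assumes F: "set_lipschitz k C F" "0 \<le> k" and T: "set_lipschitz l C T"
  shows "set_lipschitz (k * l) C (\<lambda>x. \<Union>t\<in>T x. F t)"
proof (rule set_lipschitzI)
  fix x assume x: "x \<in> C"
  note Tx = set_lipschitzD[OF T x]
  show "compact (\<Union>t\<in>T x. F t)" using compact_UN_set_lipschitz[OF F(1) Tx(1,3)] .
  obtain t where "t \<in> T x" using Tx(2) by blast
  then show "(\<Union>t\<in>T x. F t) \<noteq> {}" using Tx(3) set_lipschitzD(2)[OF F(1), of t] by blast
  show "(\<Union>t\<in>T x. F t) \<subseteq> C" using Tx(3) set_lipschitzD(3)[OF F(1)] by blast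
next
  fix x y a assume xy: "x \<in> C" "y \<in> C" and "a \<in> (\<Union>t\<in>T x. F t)"
  then obtain t where t: "t \<in> T x" "a \<in> F t" by blast
  obtain u where u: "u \<in> T y" "dist t u \<le> l * dist x y"
    using set_lipschitzD(4)[OF T xy] t by (elim covered_withinE)
  have "t \<in> C" "u \<in> C" using t u set_lipschitzD(3)[OF T] xy by blast+
  then obtain b where b: "b \<in> F u" "dist a b \<le> k * dist t u"
    using set_lipschitzD(4)[OF F(1)] t by (meson covered_withinE)
  have "k * dist t u \<le> k * (l * dist x y)" using u F(2) by (intro mult_left_mono) auto
  then show "\<exists>b\<in>(\<Union>t\<in>T y. F t). dist a b \<le> k * l * dist x y"
    using b u by (intro bexI[of _ b]) auto
qed

section \<open>Compact convex invariant sets\<close>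

text \<open>The homothety scales distances by \<open>1 - t\<close>, and its centre lies in the
  convex set \<open>C\<close>. For \<open>0 < t\<close> a nonexpansive map becomes a
  contraction.\<close>

lemma set_lipschitz_homothety:
  fixes C :: "'a::real_normed_vector set"
  assumes F: "set_lipschitz 1 C F" and C: "convex C" "x0 \<in> C" and t: "0 \<le> t" "t \<le> 1"
  shows "set_lipschitz (1 - t) C (\<lambda>x. (\<lambda>a. (1 - t) *\<^sub>R a + t *\<^sub>R x0) ` F x)"
proof (rule set_lipschitzI)
  fix x assume x: "x \<in> C"
  note Fx = set_lipschitzD[OF F x]
  show "compact ((\<lambda>a. (1 - t) *\<^sub>R a + t *\<^sub>R x0) ` F x)"
    by (intro compact_continuous_image continuous_intros Fx)
  show "(\<lambda>a. (1 - t) *\<^sub>R a + t *\<^sub>R x0) ` F x \<noteq> {}" using Fx by blast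
  show "(\<lambda>a. (1 - t) *\<^sub>R a + t *\<^sub>R x0) ` F x \<subseteq> C"
    using Fx(3) C t by (auto intro!: convexD)
next
  fix x y a assume xy: "x \<in> C" "y \<in> C" and "a \<in> (\<lambda>a. (1 - t) *\<^sub>R a + t *\<^sub>R x0) ` F x"
  then obtain a' where a': "a' \<in> F x" "a = (1 - t) *\<^sub>R a' + t *\<^sub>R x0" by blast
  then obtain b where b: "b \<in> F y" "dist a' b \<le> dist x y"
    using set_lipschitzD(4)[OF F xy] by (auto elim: covered_withinE)
  have "dist a ((1 - t) *\<^sub>R b + t *\<^sub>R x0) = (1 - t) * dist a' b"
    using a' t by (simp add: dist_norm scaleR_diff_right[symmetric])
  then show "\<exists>b\<in>(\<lambda>a. (1 - t) *\<^sub>R a + t *\<^sub>R x0) ` F y. dist a b \<le> (1 - t) * dist x y"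
    using b t by (intro bexI[OF _ imageI[OF b(1)]]) (simp add: mult_left_mono)
qed

lemma set_close_homothety:
  fixes C :: "'a::real_normed_vector set"
  assumes F: "set_lipschitz 1 C F" and C: "bounded C" "x0 \<in> C" and t: "0 \<le> t"
  shows "set_close (t * diameter C) C F (\<lambda>x. (\<lambda>a. (1 - t) *\<^sub>R a + t *\<^sub>R x0) ` F x)"
proof -
  have "dist a ((1 - t) *\<^sub>R a + t *\<^sub>R x0) \<le> t * diameter C" if "x \<in> C" "a \<in> F x" for x a
  proof -
    have "a \<in> C" using that set_lipschitzD(3)[OF F] by blast
    have "dist a ((1 - t) *\<^sub>R a + t *\<^sub>R x0) = norm (t *\<^sub>R (a - x0))"
      by (simp add: dist_norm algebra_simps)
    also have "\<dots> = t * dist a x0" using t by (simp add: dist_norm)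
    also have "\<dots> \<le> t * diameter C"
      using t diameter_bounded_bound[OF C(1) \<open>a \<in> C\<close> C(2)] by (intro mult_left_mono)
    finally show ?thesis .
  qed
  then show ?thesis
    unfolding set_close_def covered_within_def by (auto simp: dist_commute)
qed

lemma compact_finite_net:
  assumes "compact S" "0 < e"
  obtains N where "finite N" "N \<subseteq> S" "S \<subseteq> (\<Union>n\<in>N. cball n e)"
proof -
  have "S \<subseteq> (\<Union>n\<in>S. ball n e)" using assms(2) by auto
  then obtain N where "N \<subseteq> S" "finite N" "S \<subseteq> (\<Union>n\<in>N. ball n e)"
    by (rule compactE_image[OF assms(1), rotated]) auto
  moreover have "(\<Union>n\<in>N. ball n e) \<subseteq> (\<Union>n\<in>N. cball n e)" by (auto simp: less_imp_le)
  ultimately show thesis using that by (meson order_trans)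
qed

text \<open>The smallest closed convex \<open>F\<close>-invariant set containing \<open>x0\<close> is compact: a cover of it by
  finitely many balls of radius \<open>r\<close> centred in \<open>C\<close> yields one with radius \<open>k r + e\<close>, because \<open>F\<close>
  multiplies radii by \<open>k\<close> and closed convex hulls do not increase them.\<close>

lemma compact_convex_invariant_set:
  fixes C :: "'a::banach set"
  assumes F: "set_lipschitz k C F" and k: "0 \<le> k" "k < 1"
    and C: "closed C" "convex C" "bounded C" "x0 \<in> C"
  obtains K where "compact K" "convex K" "x0 \<in> K" "K \<subseteq> C" "\<And>x. x \<in> K \<Longrightarrow> F x \<subseteq> K"
proof -
  define \<S> where "\<S> = {S. closed S \<and> convex S \<and> x0 \<in> S \<and> S \<subseteq> C \<and> (\<forall>x\<in>S. F x \<subseteq> S)}"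
  define K where "K = \<Inter>\<S>"
  have "C \<in> \<S>" using C set_lipschitzD(3)[OF F] by (auto simp: \<S>_def)
  then have KC: "K \<subseteq> C" by (auto simp: K_def)
  have K: "closed K" "convex K" "x0 \<in> K" "\<forall>x\<in>K. F x \<subseteq> K"
    unfolding K_def \<S>_def by (blast intro: closed_Inter convex_Inter)+
  define cov where "cov r \<longleftrightarrow> (\<exists>N. finite N \<and> N \<subseteq> C \<and> K \<subseteq> (\<Union>n\<in>N. cball n r))" for r
  have step: "cov (k * r + e)" if r: "cov r" and e: "0 < e" for r e
  proof -
    obtain N where N: "finite N" "N \<subseteq> C" "K \<subseteq> (\<Union>n\<in>N. cball n r)"
      using r by (auto simp: cov_def)
    have "\<exists>M. finite M \<and> M \<subseteq> F n \<and> F n \<subseteq> (\<Union>m\<in>M. cball m (e / 2))" if "n \<in> N" for n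
    proof -
      have "compact (F n)" using set_lipschitzD(1)[OF F] that N(2) by blast
      then show ?thesis by (rule compact_finite_net[of _ "e / 2"]) (use e in auto)
    qed
    then obtain M where M: "\<And>n. n \<in> N \<Longrightarrow> finite (M n)" "\<And>n. n \<in> N \<Longrightarrow> M n \<subseteq> F n"
      "\<And>n. n \<in> N \<Longrightarrow> F n \<subseteq> (\<Union>m\<in>M n. cball m (e / 2))" by metis
    \<comment> \<open>Only finitely many points enter, so the hull is compact; for \<open>x\<close>
      in \<open>K\<close>, \<open>F x\<close> lies within the radius \<open>R\<close> below of
      it.\<close>
    define H where "H = convex hull (insert x0 (\<Union>n\<in>N. M n))"
    have cH: "compact H" "convex H" unfolding H_def using N(1) M(1)
      by (auto intro!: finite_imp_compact_convex_hull)
    have HC: "H \<subseteq> C" unfolding H_def using C M(2) N(2) set_lipschitzD(3)[OF F]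
      by (intro hull_minimal) blast+
    have "x0 \<in> H" unfolding H_def by (simp add: hull_inc)
    obtain n where "x0 \<in> cball n r" using subsetD[OF N(3) K(3)] by blast
    then have "dist n x0 \<le> r" by simp
    with zero_le_dist[of n x0] have r0: "0 \<le> r" by (rule order_trans) 
    define R where "R = k * r + e / 2"
    have R0: "0 \<le> R" using r0 k e by (simp add: R_def)
    \<comment> \<open>The part of \<open>K\<close> in the closed \<open>R\<close>-neighbourhood of
      \<open>H\<close>, written as a Minkowski sum to get closedness and convexity. It belongs to
      \<open>\<S>\<close>, so minimality of \<open>K\<close> forces \<open>K\<close> into that
      neighbourhood.\<close>
    define S where "S = K \<inter> (\<Union>h\<in>H. \<Union>y\<in>cball 0 R. {h + y})"
    have S_eq: "x \<in> S \<longleftrightarrow> x \<in> K \<and> (\<exists>h\<in>H. dist x h \<le> R)" for x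
    proof -
      have "(\<exists>y\<in>cball 0 R. x = h + y) \<longleftrightarrow> dist x h \<le> R" for h
      proof
        assume "dist x h \<le> R"
        then show "\<exists>y\<in>cball 0 R. x = h + y"
          by (intro bexI[of _ "x - h"]) (simp_all add: dist_norm norm_minus_commute)
      qed (auto simp: dist_norm)
      then show ?thesis by (simp add: S_def)
    qed
    have "closed S" unfolding S_def
      by (rule closed_Int[OF K(1) compact_closed_sums[OF cH(1) closed_cball]])
    moreover have "convex S" unfolding S_def
      by (rule convex_Int[OF K(2) convex_sums[OF cH(2) convex_cball]])
    moreover have "x0 \<in> S" using K(3) \<open>x0 \<in> H\<close> R0 by (auto simp: S_eq intro: bexI[of _ x0])
    moreover have "F x \<subseteq> S" if "x \<in> S" for x
    proof
      fix a assume a: "a \<in> F x"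
      have x: "x \<in> K" using that by (simp add: S_def)
      then obtain n where n: "n \<in> N" "dist n x \<le> r" using N(3) by auto
      have "covered_within (k * dist x n) (F x) (F n)"
        using set_lipschitzD(4)[OF F, of x n] x n KC N(2) by blast
      then obtain b where b: "b \<in> F n" "dist a b \<le> k * dist x n"
        using a by (auto elim: covered_withinE)
      then obtain m where m: "m \<in> M n" "dist m b \<le> e / 2" using M(3) n by force
      have "k * dist x n \<le> k * r" using n k by (intro mult_left_mono) (auto simp: dist_commute)
      then have "dist a m \<le> R" using dist_triangle[of a m b] b m by (simp add: R_def dist_commute)
      moreover have "m \<in> H" unfolding H_def using m n by (intro hull_inc) blast
      ultimately show "a \<in> S" using a x K(4) by (auto simp: S_eq)
    qed
    ultimately have "S \<in> \<S>" using KC by (auto simp: \<S>_def S_def)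
    then have KS: "K \<subseteq> S" by (auto simp: K_def)
    obtain P where P: "finite P" "P \<subseteq> H" "H \<subseteq> (\<Union>p\<in>P. cball p (e / 2))"
      using compact_finite_net[OF cH(1), of "e / 2"] e by auto
    have "K \<subseteq> (\<Union>p\<in>P. cball p (k * r + e))"
    proof
      fix x assume "x \<in> K"
      then obtain h where h: "h \<in> H" "dist x h \<le> R" using KS S_eq by blast
      then obtain p where "p \<in> P" "dist p h \<le> e / 2" using P(3) by auto
      then show "x \<in> (\<Union>p\<in>P. cball p (k * r + e))"
        using h dist_triangle[of p x h] by (auto simp: R_def dist_commute intro!: bexI[of _ p])
    qed
    then show ?thesis unfolding cov_def using P HC by blast
  qed
  have cov_mono: "cov s" if "cov r" "r \<le> s" for r s
  proof -
    have "(\<Union>n\<in>N. cball n r) \<subseteq> (\<Union>n\<in>N. cball n s)" for N :: "'a set" using that by auto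
    then show ?thesis using that(1) unfolding cov_def by (meson order_trans)
  qed
  have small: "cov e" if e: "0 < e" for e
  proof -
    have "cov (k ^ n * diameter C + e / 2)" for n
    proof (induction n)
      case 0
      have "K \<subseteq> cball x0 (diameter C)"
        using KC diameter_bounded_bound[OF C(3) C(4)] by auto
      then have "cov (diameter C)" unfolding cov_def using C(4) by (intro exI[of _ "{x0}"]) auto
      then show ?case using e by (auto elim: cov_mono)
    next
      case (Suc n)
      \<comment> \<open>The increment \<open>(1 - k) * e / 2\<close> restores the error to exactly
        \<open>e / 2\<close>, so errors do not accumulate.\<close>
      have "cov (k * (k ^ n * diameter C + e / 2) + (1 - k) * e / 2)"
        using Suc k e by (intro step) auto
      then show ?case by (simp add: algebra_simps add_divide_distrib diff_divide_distrib)
    qed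
    moreover have "(\<lambda>n. k ^ n * diameter C) \<longlonglongrightarrow> 0 * diameter C"
      using k by (intro tendsto_intros LIMSEQ_realpow_zero)
    then have "\<forall>\<^sub>F n in sequentially. k ^ n * diameter C < e / 2"
      using e by (intro order_tendstoD) auto
    then obtain n where "k ^ n * diameter C < e / 2" by (auto simp: eventually_sequentially)
    ultimately show ?thesis using cov_mono[of "k ^ n * diameter C + e / 2" e] by simp
  qed
  have "\<exists>N. finite N \<and> K \<subseteq> (\<Union>n\<in>N. ball n e)" if e: "0 < e" for e
  proof -
    obtain N where N: "finite N" "K \<subseteq> (\<Union>n\<in>N. cball n (e / 2))"
      using small[of "e / 2"] e by (auto simp: cov_def)
    have "(\<Union>n\<in>N. cball n (e / 2)) \<subseteq> (\<Union>n\<in>N. ball n e)" using e by auto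
    with N(2) have "K \<subseteq> (\<Union>n\<in>N. ball n e)" by (rule order_trans)
    with N(1) show ?thesis by (intro exI conjI)
  qed
  then have "compact K"
    using K(1) by (simp add: compact_eq_totally_bounded complete_eq_closed)
  then show thesis using K(2,3) KC bspec[OF K(4)] by (rule that)
qed

section \<open>A multivalued retraction near a compact convex set\<close>

text \<open>The point \<open>z\<close> moves towards \<open>q\<close> by \<open>1 + \<eta>\<close>
  times the displacement \<open>h\<close> of \<open>x\<close>. If it does not arrive, it covers a
  fraction \<open>\<theta>\<close> of the segment and gains \<open>\<theta> * (D + h - b)\<close> in
  the bound on its distance to \<open>y\<close>. The last assumption gives
  \<open>dist z q \<le> D + h + b \<le> (1 + \<eta>) * (D + h - b)\<close>, so the gain pays for
  \<open>h\<close>.\<close>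

lemma follow_in_convex:
  fixes K :: "'a::real_normed_vector set"
  assumes K: "convex K" "z \<in> K" "q \<in> K" and d: "dist x z \<le> D" "dist y q \<le> b"
    and b: "0 \<le> b" "0 < \<eta>" "(2 + \<eta>) * b \<le> \<eta> * D"
  obtains z' where "z' \<in> K" "dist y z' \<le> D" "dist z z' \<le> (1 + \<eta>) * dist x y"
proof (cases "dist z q \<le> (1 + \<eta>) * dist x y")
  case True
  have "\<eta> * b \<le> (2 + \<eta>) * b" using b by (intro mult_right_mono) auto
  then have "\<eta> * b \<le> \<eta> * D" using b(3) by (rule order_trans)
  then have "b \<le> D" using b by simp
  then show thesis using that[of q] True K d by simp
next
  case False
  define h where "h = dist x y"
  define \<theta> where "\<theta> = (1 + \<eta>) * h / dist z q"
  have zq: "0 < dist z q" using False b by (smt (verit) mult_nonneg_nonneg zero_le_dist)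
  have \<theta>: "0 \<le> \<theta>" "\<theta> \<le> 1" "\<theta> * dist z q = (1 + \<eta>) * h"
    using False b zq by (auto simp: \<theta>_def h_def divide_simps)
  define z' where "z' = (1 - \<theta>) *\<^sub>R z + \<theta> *\<^sub>R q"
  have "z' \<in> K" unfolding z'_def using K \<theta> by (intro convexD) auto
  moreover have "dist z z' = \<theta> * dist z q"
  proof -
    have "z - z' = \<theta> *\<^sub>R (z - q)" by (simp add: z'_def algebra_simps)
    then show ?thesis using \<theta> by (simp add: dist_norm)
  qed
  then have "dist z z' \<le> (1 + \<eta>) * dist x y" using \<theta> by (simp add: h_def)
  moreover have "dist y z' \<le> D"
  proof -
    have "y - z' = (1 - \<theta>) *\<^sub>R (y - z) + \<theta> *\<^sub>R (y - q)" by (simp add: z'_def algebra_simps)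
    then have "dist y z' \<le> (1 - \<theta>) * dist y z + \<theta> * dist y q"
      using norm_triangle_ineq[of "(1 - \<theta>) *\<^sub>R (y - z)" "\<theta> *\<^sub>R (y - q)"] \<theta> by (simp add: dist_norm)
    also have "\<dots> \<le> (1 - \<theta>) * (D + h) + \<theta> * b"
      using \<theta> d dist_triangle[of y z x] by (intro add_mono mult_left_mono) (auto simp: h_def dist_commute)
    also have "\<dots> = D + (h - \<theta> * (D + h - b))" by (simp add: algebra_simps)
    also have "\<dots> \<le> D"
    proof -
      have "dist z q \<le> D + h + b"
        using dist_triangle[of z q x] dist_triangle[of x q y] d by (simp add: h_def dist_commute)
      also have "\<dots> \<le> (1 + \<eta>) * (D + h - b)"
      proof -
        have "(1 + \<eta>) * (D + h - b) - (D + h + b) = \<eta> * D + \<eta> * h - (2 + \<eta>) * b"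
          by (simp add: algebra_simps)
        moreover have "0 \<le> \<eta> * h" using b by (simp add: h_def)
        ultimately show ?thesis using b by linarith
      qed
      finally have "h * dist z q \<le> h * ((1 + \<eta>) * (D + h - b))"
        by (rule mult_left_mono) (simp add: h_def)
      also have "\<dots> = dist z q * (\<theta> * (D + h - b))" using \<theta>(3) by (simp add: mult_ac)
      finally have "h \<le> \<theta> * (D + h - b)" using zq by (simp add: mult.commute)
      then show ?thesis by simp
    qed
    finally show ?thesis .
  qed
  ultimately show thesis using that by blast
qed

text \<open>A ramp from 0 at \<open>b / 2\<close> to 1 at \<open>b\<close>, written with minima so
  that sums over the scales \<open>b0 / 2 ^ j\<close> telescope.\<close>

definition pull_weight :: "real \<Rightarrow> real \<Rightarrow> real" where
  "pull_weight b s = (min s b - min s (b / 2)) / (b / 2)"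

text \<open>For \<open>m = 1\<close> the coefficient of \<open>z\<close> vanishes; lifting the
  restriction on \<open>z\<close> then yields \<open>{x}\<close> for non-empty \<open>K\<close>,
  instead of an empty set far from \<open>K\<close>.\<close>

definition pull :: "'a::real_normed_vector set \<Rightarrow> real \<Rightarrow> real \<Rightarrow> 'a \<Rightarrow> 'a set" where
  "pull K b D x = (let m = pull_weight b (infdist x K)
     in (\<lambda>z. m *\<^sub>R x + (1 - m) *\<^sub>R z) ` {z \<in> K. m = 1 \<or> dist x z \<le> D})"

lemma pull_weight_bounds:
  assumes "0 < b" shows "0 \<le> pull_weight b s" "pull_weight b s \<le> 1"
  using assms by (auto simp: pull_weight_def field_simps min_def)

lemma pull_weight_eq_1: "0 < b \<Longrightarrow> b \<le> s \<Longrightarrow> pull_weight b s = 1"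
  by (auto simp: pull_weight_def field_simps min_def)

lemma pull_weight_eq_0: "0 < b \<Longrightarrow> s \<le> b / 2 \<Longrightarrow> pull_weight b s = 0"
  by (auto simp: pull_weight_def field_simps min_def)

lemma pull_weight_mono: "0 < b \<Longrightarrow> s \<le> t \<Longrightarrow> pull_weight b s \<le> pull_weight b t"
  unfolding pull_weight_def by (intro divide_right_mono) (auto simp: min_def)

context
  fixes K :: "'a::real_normed_vector set" and b D \<eta> :: real
  assumes K: "compact K" "convex K" "K \<noteq> {}"
    and b: "0 < b" "0 < \<eta>" "(2 + \<eta>) * b \<le> \<eta> * D"
begin

lemma pull_scale_le: "b \<le> D"
proof -
  have "\<eta> * b \<le> (2 + \<eta>) * b" using b by (intro mult_right_mono) auto
  then have "\<eta> * b \<le> \<eta> * D" using b(3) by (rule order_trans)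
  then show ?thesis using b by simp
qed

lemma pull_near:
  assumes "pull_weight b (infdist x K) \<noteq> 1"
  obtains q where "q \<in> K" "dist x q \<le> b"
proof -
  obtain q where "q \<in> K" "infdist x K = dist x q" using compact_infdist_attained K by metis
  then show thesis using that[of q] assms pull_weight_eq_1[OF b(1), of "infdist x K"] by force
qed

lemma pull_nonempty: "pull K b D x \<noteq> {}"
proof (cases "pull_weight b (infdist x K) = 1")
  case True
  then show ?thesis using K by (auto simp: pull_def Let_def)
next
  case False
  then obtain q where "q \<in> K" "dist x q \<le> b" by (rule pull_near)
  then have "q \<in> {z \<in> K. pull_weight b (infdist x K) = 1 \<or> dist x z \<le> D}"
    using pull_scale_le by auto
  then show ?thesis by (auto simp: pull_def Let_def)
qed

lemma compact_pull: "compact (pull K b D x)"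
proof -
  have "{z \<in> K. pull_weight b (infdist x K) = 1 \<or> dist x z \<le> D} =
      (if pull_weight b (infdist x K) = 1 then K else K \<inter> cball x D)" by auto
  then have "compact {z \<in> K. pull_weight b (infdist x K) = 1 \<or> dist x z \<le> D}"
    using K by (simp add: compact_Int_closed)
  then show ?thesis unfolding pull_def Let_def
    by (intro compact_continuous_image continuous_intros)
qed

lemma pull_subset_convex:
  assumes "convex C" "K \<subseteq> C" "x \<in> C"
  shows "pull K b D x \<subseteq> C"
  using assms pull_weight_bounds[OF b(1), of "infdist x K"]
  by (auto simp: pull_def Let_def intro!: convexD)

lemma pull_subset_cball: "pull K b D x \<subseteq> cball x D"
proof
  fix a assume "a \<in> pull K b D x"
  then obtain z where z: "pull_weight b (infdist x K) = 1 \<or> dist x z \<le> D"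
    "a = pull_weight b (infdist x K) *\<^sub>R x + (1 - pull_weight b (infdist x K)) *\<^sub>R z"
    by (auto simp: pull_def Let_def)
  define m where "m = pull_weight b (infdist x K)"
  have m: "0 \<le> m" "m \<le> 1" using pull_weight_bounds[OF b(1)] by (auto simp: m_def)
  have "x - a = (1 - m) *\<^sub>R (x - z)" using z by (simp add: m_def algebra_simps)
  then have eq: "dist x a = (1 - m) * dist x z" using m by (simp add: dist_norm)
  have "(1 - m) * dist x z \<le> D"
  proof (cases "m = 1")
    case False
    then have "dist x z \<le> D" using z by (simp add: m_def)
    then have "(1 - m) * dist x z \<le> 1 * D" using m by (intro mult_mono) auto
    then show ?thesis by simp
  qed (use pull_scale_le b in simp)
  then show "a \<in> cball x D" using eq by simp
qed

lemma pull_subset_target: "infdist x K \<le> b / 2 \<Longrightarrow> pull K b D x \<subseteq> K"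
  using pull_weight_eq_0[OF b(1), of "infdist x K"] by (auto simp: pull_def Let_def)

text \<open>For \<open>m x \<noteq> 1\<close> three motions add up: \<open>x\<close> moves with
  weight \<open>m y\<close>, its companion \<open>z\<close> follows with weight
  \<open>1 - m y\<close> by \<open>follow_in_convex\<close>, and the shift of weight costs at most
  \<open>D\<close> per unit, because \<open>z\<close> is within \<open>D\<close> of
  \<open>x\<close>.\<close>

lemma pull_covered:
  defines "m \<equiv> \<lambda>x. pull_weight b (infdist x K)"
  shows "covered_within ((1 + \<eta>) * dist x y + \<bar>m x - m y\<bar> * D) (pull K b D x) (pull K b D y)"
proof (rule covered_withinI)
  fix a assume "a \<in> pull K b D x"
  then obtain z where z: "z \<in> K" "m x = 1 \<or> dist x z \<le> D" "a = m x *\<^sub>R x + (1 - m x) *\<^sub>R z"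
    by (auto simp: pull_def Let_def m_def)
  have m: "0 \<le> m u" "m u \<le> 1" for u using pull_weight_bounds[OF b(1)] by (auto simp: m_def)
  \<comment> \<open>If \<open>m y = 1\<close>, the choice of \<open>z'\<close> has no effect. If
    \<open>m x = 1\<close>, \<open>z\<close> may be far from \<open>x\<close> and cannot be
    followed, so a point near \<open>y\<close> is taken afresh.\<close>
  obtain z' where z': "z' \<in> K" "m y = 1 \<or> dist y z' \<le> D"
    "(1 - m y) * dist z z' \<le> (1 - m y) * ((1 + \<eta>) * dist x y) \<or> m x = 1"
  proof (cases "m y = 1")
    case True
    then show thesis using that[of z] z by simp
  next
    case False
    then obtain q where q: "q \<in> K" "dist y q \<le> b" using pull_near unfolding m_def by blast
    show thesis
    proof (cases "m x = 1")
      case True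
      then show thesis using that[of q] q pull_scale_le by simp
    next
      case False
      then have "dist x z \<le> D" using z by simp
      from follow_in_convex[OF K(2) z(1) q(1) this q(2) less_imp_le[OF b(1)] b(2,3)]
      obtain z' where "z' \<in> K" "dist y z' \<le> D" "dist z z' \<le> (1 + \<eta>) * dist x y" .
      then show thesis using that[of z'] m[of y] by (simp add: mult_left_mono)
    qed
  qed
  define a' where "a' = m y *\<^sub>R y + (1 - m y) *\<^sub>R z'"
  have "a' \<in> pull K b D y" using z' by (auto simp: pull_def Let_def m_def a'_def)
  moreover have "dist a a' \<le> (1 + \<eta>) * dist x y + \<bar>m x - m y\<bar> * D"
  proof (cases "m x = 1")
    case True
    \<comment> \<open>Here \<open>a = x\<close>, and \<open>1 - m y\<close> is the change of weight,
      to which the lag of \<open>z'\<close> is charged.\<close>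
    have "a - a' = (x - y) + (1 - m y) *\<^sub>R (y - z')"
      using True z by (simp add: a'_def algebra_simps)
    then have "dist a a' \<le> dist x y + (1 - m y) * dist y z'"
      using norm_triangle_ineq[of "x - y" "(1 - m y) *\<^sub>R (y - z')"] m[of y] by (simp add: dist_norm)
    also have "(1 - m y) * dist y z' \<le> \<bar>m x - m y\<bar> * D"
      using z'(2) True m[of y] by (cases "m y = 1") (simp_all add: mult_left_mono)
    also have "dist x y \<le> (1 + \<eta>) * dist x y" using b(2) by (simp add: distrib_right)
    finally show ?thesis by simp
  next
    case False
    then have xz: "dist x z \<le> D" using z by simp
    have "a - a' = m y *\<^sub>R (x - y) + (1 - m y) *\<^sub>R (z - z') + (m x - m y) *\<^sub>R (x - z)"
      using z by (simp add: a'_def algebra_simps)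
    then have "dist a a' \<le> norm (m y *\<^sub>R (x - y)) + norm ((1 - m y) *\<^sub>R (z - z'))
        + norm ((m x - m y) *\<^sub>R (x - z))"
      unfolding dist_norm
      by (simp only: order_trans[OF norm_triangle_ineq add_right_mono[OF norm_triangle_ineq]])
    also have "\<dots> = m y * dist x y + (1 - m y) * dist z z' + \<bar>m x - m y\<bar> * dist x z"
      using m[of y] by (simp add: dist_norm)
    also have "\<dots> \<le> m y * ((1 + \<eta>) * dist x y) + (1 - m y) * ((1 + \<eta>) * dist x y)
        + \<bar>m x - m y\<bar> * D"
    proof (intro add_mono)
      have "1 * dist x y \<le> (1 + \<eta>) * dist x y" using b by (intro mult_right_mono) auto
      then show "m y * dist x y \<le> m y * ((1 + \<eta>) * dist x y)" using m[of y] by (intro mult_left_mono) auto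
      show "(1 - m y) * dist z z' \<le> (1 - m y) * ((1 + \<eta>) * dist x y)" using z'(3) False by blast
      show "\<bar>m x - m y\<bar> * dist x z \<le> \<bar>m x - m y\<bar> * D" using xz by (intro mult_left_mono) auto
    qed
    finally show ?thesis by (simp add: algebra_simps)
  qed
  ultimately show "\<exists>a'\<in>pull K b D y. dist a a' \<le> (1 + \<eta>) * dist x y + \<bar>m x - m y\<bar> * D"
    by blast
qed

end

section \<open>Minkowski averages over dyadic scales\<close>

primrec sumset :: "(nat \<Rightarrow> 'a::real_normed_vector set) \<Rightarrow> nat \<Rightarrow> 'a set" where
  "sumset A 0 = {0}"
| "sumset A (Suc n) = {a + b |a b. a \<in> sumset A n \<and> b \<in> A n}"

lemma compact_sumset: "(\<And>j. compact (A j)) \<Longrightarrow> compact (sumset A n)"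
proof (induction n)
  case (Suc n)
  then show ?case using compact_sums[of "sumset A n" "A n"] by simp
qed simp

lemma sumset_nonempty: "(\<And>j. A j \<noteq> {}) \<Longrightarrow> sumset A n \<noteq> {}"
  by (induction n) auto

lemma covered_within_sumset:
  assumes "\<And>j. covered_within (r j) (A j) (B j)"
  shows "covered_within (\<Sum>j<n. r j) (sumset A n) (sumset B n)"
proof (induction n)
  case 0
  then show ?case by (simp add: covered_within_def)
next
  case (Suc n)
  show ?case
  proof (rule covered_withinI)
    fix c assume "c \<in> sumset A (Suc n)"
    then obtain a a' where a: "a \<in> sumset A n" "a' \<in> A n" "c = a + a'" by auto
    obtain b where b: "b \<in> sumset B n" "dist a b \<le> (\<Sum>j<n. r j)"
      using covered_withinE[OF Suc a(1)] .
    obtain b' where b': "b' \<in> B n" "dist a' b' \<le> r n"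
      using covered_withinE[OF assms a(2)] .
    have "dist (a + a') (b + b') \<le> dist a b + dist a' b'" by (rule dist_triangle_add)
    then show "\<exists>d\<in>sumset B (Suc n). dist c d \<le> (\<Sum>j<Suc n. r j)"
      using a b b' by (intro bexI[of _ "b + b'"]) auto
  qed
qed

lemma sumset_average_subset:
  assumes "convex S" "\<And>j. j < n \<Longrightarrow> A j \<subseteq> S" "0 < n"
  shows "(\<lambda>a. (1 / real n) *\<^sub>R a) ` sumset A n \<subseteq> S"
proof -
  have "\<exists>t. (\<forall>j<n. t j \<in> A j) \<and> a = (\<Sum>j<n. t j)" if "a \<in> sumset A n" for a n
    using that
  proof (induction n arbitrary: a)
    case (Suc n)
    then obtain a' b where a: "a' \<in> sumset A n" "b \<in> A n" "a = a' + b" by auto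
    then obtain t where t: "\<forall>j<n. t j \<in> A j" "a' = (\<Sum>j<n. t j)" using Suc.IH by blast
    then show ?case using a by (intro exI[of _ "t(n := b)"]) (auto simp: less_Suc_eq)
  qed simp
  then have rep: "\<exists>t. (\<forall>j<n. t j \<in> A j) \<and> a = (\<Sum>j<n. t j)" if "a \<in> sumset A n" for a
    using that by blast
  show ?thesis
  proof safe
    fix a assume "a \<in> sumset A n"
    then obtain t where t: "\<forall>j<n. t j \<in> A j" "a = (\<Sum>j<n. t j)" using rep by blast
    have "(\<Sum>j\<in>{..<n}. (1 / real n) *\<^sub>R t j) \<in> S"
      using assms t(1) by (intro convex_sum) (auto simp: subset_iff)
    then show "(1 / real n) *\<^sub>R a \<in> S" by (simp add: t(2) scaleR_sum_right)
  qed
qed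

text \<open>Multiplied by the lag \<open>M * b\<close>, each ramp has slope \<open>2 * M\<close> on
  its dyadic band and is constant elsewhere. The bands overlap only in endpoints, so the slopes do
  not add up.\<close>

lemma sum_pull_weight_le:
  assumes b0: "0 < b0" and M: "0 \<le> M"
  shows "(\<Sum>j<n. \<bar>pull_weight (b0 / 2 ^ j) s - pull_weight (b0 / 2 ^ j) t\<bar> * (M * (b0 / 2 ^ j)))
    \<le> 2 * M * \<bar>s - t\<bar>"
proof -
  have *: "(\<Sum>j<n. \<bar>pull_weight (b0 / 2 ^ j) s - pull_weight (b0 / 2 ^ j) t\<bar> * (M * (b0 / 2 ^ j)))
    \<le> 2 * M * (t - s)" if "s \<le> t" for s t
  proof -
    \<comment> \<open>The length of the part of the interval from \<open>s\<close> to
      \<open>t\<close> below \<open>b0 / 2 ^ j\<close>; successive differences are the lengths in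
      the bands.\<close>
    define g where "g j = min t (b0 / 2 ^ j) - min s (b0 / 2 ^ j)" for j :: nat
    have "\<bar>pull_weight (b0 / 2 ^ j) s - pull_weight (b0 / 2 ^ j) t\<bar> * (M * (b0 / 2 ^ j))
        = 2 * M * (g j - g (Suc j))" for j
    proof -
      define c where "c = b0 / 2 ^ j"
      have c: "0 < c" "b0 / 2 ^ Suc j = c / 2" using b0 by (auto simp: c_def)
      have "\<bar>pull_weight c s - pull_weight c t\<bar> = pull_weight c t - pull_weight c s"
        using pull_weight_mono[OF c(1) that] by simp
      also have "\<dots> * (M * c) = 2 * M * ((min t c - min s c) - (min t (c / 2) - min s (c / 2)))"
        using c by (simp add: pull_weight_def field_simps)
      finally show ?thesis by (simp only: g_def c(2) c_def[symmetric])
    qed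
    then have "(\<Sum>j<n. \<bar>pull_weight (b0 / 2 ^ j) s - pull_weight (b0 / 2 ^ j) t\<bar> * (M * (b0 / 2 ^ j)))
      = 2 * M * (\<Sum>j<n. g j - g (Suc j))" by (simp add: sum_distrib_left)
    also have "(\<Sum>j<n. g j - g (Suc j)) = g 0 - g n" by (rule sum_lessThan_telescope')
    also have "2 * M * (g 0 - g n) \<le> 2 * M * (t - s)"
      using that M by (intro mult_left_mono) (auto simp: g_def min_def)
    finally show ?thesis .
  qed
  show ?thesis
  proof (cases "s \<le> t")
    case False
    then show ?thesis using *[of t s] by (simp add: abs_minus_commute)
  qed (use * in simp)
qed

text \<open>At distance about \<open>b\<close> from \<open>K\<close>, a point of \<open>K\<close> can follow \<open>x\<close> with speed \<open>1 + \<eta>\<close> only if it may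
  lag behind by \<open>b / \<eta>\<close>, so on one scale only a small fraction of the weight can be moved from \<open>x\<close>
  to \<open>K\<close>. Averaging over \<open>J\<close> dyadic scales moves all of it: the weights vary on disjoint ranges of
  the distance, hence their variations do not add up.\<close>

lemma multivalued_retraction:
  fixes C :: "'a::real_normed_vector set"
  assumes K: "compact K" "convex K" "K \<noteq> {}" "K \<subseteq> C" and C: "convex C"
    and e: "0 < e" "0 < \<eta>"
  obtains T \<rho> where "0 < \<rho>" "set_lipschitz (1 + \<eta>) C T" "\<And>x. T x \<subseteq> cball x e"
    "\<And>x. infdist x K \<le> \<rho> \<Longrightarrow> T x \<subseteq> K"
proof -
  \<comment> \<open>Half of the excess \<open>\<eta>\<close> is for following in \<open>K\<close>,
    half for the variation of the weights. \<open>M\<close> makes the condition of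
    \<open>follow_in_convex\<close> an equality for \<open>D = M * b\<close>; \<open>b0\<close>
    keeps all lags at most \<open>e\<close>, and averaging over \<open>J\<close> scales reduces the
    slope \<open>2 * M\<close> to at most \<open>\<theta>\<close>.\<close>
  define \<theta> where "\<theta> = \<eta> / 2"
  define M where "M = (2 + \<theta>) / \<theta>"
  have \<theta>: "0 < \<theta>" and M: "0 < M" "(2 + \<theta>) = \<theta> * M" using e by (auto simp: \<theta>_def M_def)
  define b0 where "b0 = e / M"
  define b where "b j = b0 / 2 ^ j" for j :: nat
  have b0: "0 < b0" and b: "0 < b j" "b j \<le> b0" "(2 + \<theta>) * b j \<le> \<theta> * (M * b j)" for j
    using e M by (auto simp: b0_def b_def field_simps)
  obtain n :: nat where n: "2 * M / \<theta> \<le> real n" using real_arch_simple by blast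
  define J where "J = Suc n"
  have J: "0 < J" "2 * M / real J \<le> \<theta>" using n \<theta> M by (auto simp: J_def field_simps)
  define A where "A x j = pull K (b j) (M * b j) x" for x j
  define T where "T x = (\<lambda>a. (1 / real J) *\<^sub>R a) ` sumset (A x) J" for x
  note pull = K(1-3) b(1) \<theta> b(3)
  have "set_lipschitz (1 + \<eta>) C T"
  proof (rule set_lipschitzI)
    fix x
    show "compact (T x)" unfolding T_def A_def
      by (intro compact_continuous_image continuous_intros compact_sumset compact_pull[OF pull])
    have "sumset (A x) J \<noteq> {}"
      by (rule sumset_nonempty) (simp add: A_def pull_nonempty[OF pull])
    then show "T x \<noteq> {}" by (simp add: T_def)
    show "T x \<subseteq> C" if "x \<in> C" unfolding T_def A_def
      using pull_subset_convex[OF pull C K(4) that] J by (intro sumset_average_subset C) auto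
  next
    fix x y a assume xy: "x \<in> C" "y \<in> C" and "a \<in> T x"
    then obtain a' where a': "a' \<in> sumset (A x) J" "a = (1 / real J) *\<^sub>R a'" by (auto simp: T_def)
    define r where "r j = (1 + \<theta>) * dist x y +
      \<bar>pull_weight (b j) (infdist x K) - pull_weight (b j) (infdist y K)\<bar> * (M * b j)" for j
    have "covered_within (\<Sum>j<J. r j) (sumset (A x) J) (sumset (A y) J)"
      unfolding A_def r_def by (intro covered_within_sumset pull_covered[OF pull])
    then obtain c where c: "c \<in> sumset (A y) J" "dist a' c \<le> (\<Sum>j<J. r j)"
      using a' by (elim covered_withinE)
    have "(\<Sum>j<J. r j) \<le> real J * ((1 + \<theta>) * dist x y) + 2 * M * \<bar>infdist x K - infdist y K\<bar>"
      using sum_pull_weight_le[OF b0, of M "infdist x K" "infdist y K" J] M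
      by (simp add: r_def b_def sum.distrib)
    also have "\<dots> \<le> real J * ((1 + \<theta>) * dist x y) + 2 * M * dist x y"
      using infdist_triangle[of x K y] infdist_triangle[of y K x] M
      by (intro add_left_mono mult_left_mono) (auto simp: dist_commute abs_if)
    finally have "dist a' c \<le> real J * ((1 + \<theta>) * dist x y) + 2 * M * dist x y" using c by linarith
    then have "dist a' c / real J \<le> (1 + \<theta>) * dist x y + (2 * M / real J) * dist x y"
      using J by (simp add: field_simps)
    also have "\<dots> \<le> (1 + \<theta>) * dist x y + \<theta> * dist x y"
      using J by (intro add_left_mono mult_right_mono) auto
    also have "\<dots> = (1 + \<eta>) * dist x y" by (simp add: \<theta>_def algebra_simps)
    finally have "dist a ((1 / real J) *\<^sub>R c) \<le> (1 + \<eta>) * dist x y"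
      using J by (simp add: a' dist_norm flip: scaleR_diff_right)
    then show "\<exists>c\<in>T y. dist a c \<le> (1 + \<eta>) * dist x y" using c by (auto simp: T_def)
  qed
  moreover have "T x \<subseteq> cball x e" for x
  proof -
    have "A x j \<subseteq> cball x e" for j
    proof -
      have "M * b j \<le> e" using b(2)[of j] M by (simp add: b0_def field_simps)
      then show ?thesis using pull_subset_cball[OF pull, of j x] by (auto simp: A_def)
    qed
    then show ?thesis unfolding T_def using J by (intro sumset_average_subset) auto
  qed
  \<comment> \<open>The scale \<open>b J\<close> is one beyond the last in use: it is at most
    \<open>b j / 2\<close> for each \<open>j < J\<close>, so all weights vanish.\<close>
  moreover have "T x \<subseteq> K" if "infdist x K \<le> b J" for x
  proof -
    have "A x j \<subseteq> K" if "j < J" for j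
    proof -
      have "(2::real) ^ Suc j \<le> 2 ^ J" using that by (intro power_increasing) auto
      then have "b J \<le> b0 / 2 ^ Suc j" unfolding b_def using b0 by (intro divide_left_mono) auto
      then have "b J \<le> b j / 2" by (simp add: b_def)
      then show ?thesis using \<open>infdist x K \<le> b J\<close> pull_subset_target[OF pull, of x j]
        by (simp add: A_def)
    qed
    then show ?thesis unfolding T_def using J K by (intro sumset_average_subset) auto
  qed
  ultimately show thesis using that[of "b J" T] b(1) by blast
qed

section \<open>Pursuit by finitely many tokens\<close>

definition trunc :: "real \<Rightarrow> 'a::real_normed_vector \<Rightarrow> 'a" where
  "trunc R u = (if norm u \<le> R then u else (R / norm u) *\<^sub>R u)"

lemma trunc_scaleR:
  assumes "0 \<le> R" obtains t where "0 \<le> t" "t \<le> 1" "trunc R u = t *\<^sub>R u"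
proof (cases "norm u \<le> R")
  case True
  then show thesis using that[of 1] by (simp add: trunc_def)
next
  case False
  moreover from this assms have "0 < norm u" by linarith
  ultimately show thesis using that[of "R / norm u"] assms by (simp add: trunc_def)
qed

lemma trunc_0 [simp]: "0 \<le> R \<Longrightarrow> trunc R 0 = 0"
  by (simp add: trunc_def)

lemma norm_trunc_le: "0 \<le> R \<Longrightarrow> norm (trunc R u) \<le> R"
  by (auto simp: trunc_def)

lemma norm_diff_trunc: "0 \<le> R \<Longrightarrow> norm (u - trunc R u) = max 0 (norm u - R)"
proof (cases "norm u \<le> R")
  case False
  assume R: "0 \<le> R"
  with False have u: "0 < norm u" by linarith
  have "u - trunc R u = (1 - R / norm u) *\<^sub>R u" using False by (simp add: trunc_def algebra_simps)
  moreover have "0 \<le> 1 - R / norm u" using False u by (simp add: divide_le_eq_1)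
  ultimately have "norm (u - trunc R u) = (1 - R / norm u) * norm u" by simp
  also have "\<dots> = norm u - R" using u by (simp add: field_simps)
  finally show ?thesis using False by simp
qed (simp add: trunc_def)

lemma norm_trunc_radius_le:
  assumes "0 \<le> R" "R \<le> S" shows "norm (trunc S u - trunc R u) \<le> S - R"
proof (cases "norm u \<le> S")
  case True
  then show ?thesis using norm_diff_trunc[OF assms(1), of u] assms by (auto simp: trunc_def)
next
  case False
  then have u: "0 < norm u" "\<not> norm u \<le> R" using assms by auto
  have "trunc S u - trunc R u = ((S - R) / norm u) *\<^sub>R u"
    using False u by (simp add: trunc_def diff_divide_distrib scaleR_diff_left)
  then show ?thesis using assms u by simp
qed

text \<open>For \<open>norm u \<le> norm w\<close> the error beyond \<open>norm (u - w)\<close> is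
  at most \<open>norm w - norm u\<close>, which comes from the radial factors. This gives the factor
  2 without an inner product.\<close>

lemma norm_trunc_le_double:
  assumes "0 \<le> R" shows "norm (trunc R u - trunc R w) \<le> 2 * norm (u - w)"
proof -
  have *: "norm (trunc R u - trunc R w) \<le> 2 * norm (u - w)" if uw: "norm u \<le> norm w" for u w :: 'a
  proof (cases "norm w \<le> R")
    case True
    then show ?thesis using uw by (simp add: trunc_def)
  next
    case w: False
    show ?thesis
    proof (cases "norm u \<le> R")
      case True
      have "norm (u - trunc R w) \<le> norm (u - w) + norm (w - trunc R w)"
        using norm_triangle_ineq[of "u - w" "w - trunc R w"] by simp
      also have "norm (w - trunc R w) \<le> norm w - norm u"
        using norm_diff_trunc[OF assms, of w] w True by simp
      finally show ?thesis using True norm_triangle_ineq2[of w u] by (simp add: trunc_def norm_minus_commute)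
    next
      case False
      have pos: "0 < norm u" "0 < norm w" using False w assms by auto
      have "trunc R u - trunc R w = (R / norm w) *\<^sub>R (u - w) + (R / norm u - R / norm w) *\<^sub>R u"
        using False w by (simp add: trunc_def algebra_simps)
      then have "norm (trunc R u - trunc R w)
          \<le> norm ((R / norm w) *\<^sub>R (u - w)) + norm ((R / norm u - R / norm w) *\<^sub>R u)"
        by (simp only: norm_triangle_ineq)
      also have "norm ((R / norm u - R / norm w) *\<^sub>R u) = (R / norm w) * (norm w - norm u)"
      proof -
        have "R / norm w \<le> R / norm u" using uw pos assms by (intro divide_left_mono) auto
        then have "norm ((R / norm u - R / norm w) *\<^sub>R u) = (R / norm u - R / norm w) * norm u" by simp
        also have "\<dots> = (R / norm w) * (norm w - norm u)" using pos by (simp add: field_simps)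
        finally show ?thesis .
      qed
      also have "norm ((R / norm w) *\<^sub>R (u - w)) = (R / norm w) * norm (u - w)"
        using assms by simp
      also have "(R / norm w) * norm (u - w) + (R / norm w) * (norm w - norm u)
          \<le> 1 * norm (u - w) + 1 * norm (u - w)"
        using w pos norm_triangle_ineq2[of w u] uw assms
        by (intro add_mono mult_mono) (auto simp: norm_minus_commute)
      finally show ?thesis by simp
    qed
  qed
  show ?thesis
  proof (cases "norm u \<le> norm w")
    case False
    then show ?thesis using *[of w u] by (simp add: norm_minus_commute)
  qed (rule *)
qed

lemma norm_trunc_diff_le:
  assumes "0 \<le> R" "0 \<le> S"
  shows "norm (trunc R u - trunc S w) \<le> \<bar>R - S\<bar> + 2 * norm (u - w)"
proof -
  have "norm (trunc R u - trunc S u) \<le> \<bar>R - S\<bar>"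
    using norm_trunc_radius_le[of R S u] norm_trunc_radius_le[of S R u] assms
    by (cases "R \<le> S") (auto simp: norm_minus_commute)
  moreover have "norm (trunc S u - trunc S w) \<le> 2 * norm (u - w)"
    by (rule norm_trunc_le_double[OF assms(2)])
  ultimately show ?thesis
    using norm_triangle_ineq[of "trunc R u - trunc S u" "trunc S u - trunc S w"] by simp
qed

lemma continuous_on_trunc:
  fixes f :: "'b::topological_space \<Rightarrow> 'a::real_normed_vector"
  assumes "continuous_on Z r" "continuous_on Z f" "\<And>z. z \<in> Z \<Longrightarrow> 0 \<le> r z"
  shows "continuous_on Z (\<lambda>z. trunc (r z) (f z))"
  unfolding continuous_on_def
proof
  fix a assume a: "a \<in> Z"
  have "(r \<longlongrightarrow> r a) (at a within Z)" "(f \<longlongrightarrow> f a) (at a within Z)"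
    using assms a by (auto simp: continuous_on_def)
  then have "((\<lambda>z. \<bar>r z - r a\<bar> + 2 * norm (f z - f a)) \<longlongrightarrow> \<bar>r a - r a\<bar> + 2 * norm (f a - f a)) (at a within Z)"
    by (intro tendsto_intros)
  then have 0: "((\<lambda>z. \<bar>r z - r a\<bar> + 2 * norm (f z - f a)) \<longlongrightarrow> 0) (at a within Z)" by simp
  have "\<forall>\<^sub>F z in at a within Z. norm (trunc (r z) (f z) - trunc (r a) (f a)) \<le> \<bar>r z - r a\<bar> + 2 * norm (f z - f a)"
    unfolding eventually_at_filter
    by (rule always_eventually) (use assms(3) a in \<open>blast intro: norm_trunc_diff_le\<close>)
  from Lim_null_comparison[OF this 0]
  show "((\<lambda>z. trunc (r z) (f z)) \<longlongrightarrow> trunc (r a) (f a)) (at a within Z)"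
    by (simp add: LIM_zero_iff)
qed

text \<open>As \<open>v\<close> grows from 0 to 1, \<open>K\<close> is deformed into points of the
  net \<open>P\<close> along segments of length at most \<open>w\<close>. All net points within
  \<open>w\<close> are used, since a choice of one need not depend continuously on
  \<open>y\<close>.\<close>

definition labels :: "'a::real_normed_vector set \<Rightarrow> 'a set \<Rightarrow> real \<Rightarrow> real \<Rightarrow> 'a set" where
  "labels K P w v = (\<lambda>(y, r). (1 - v) *\<^sub>R y + v *\<^sub>R r) ` {(y, r) \<in> K \<times> P. dist y r \<le> w}"

text \<open>\<open>c q\<close> is the slack before \<open>q\<close> is too far from the pursued set.
  The token waits on the segment from \<open>q\<close> to \<open>p\<close> at distance
  \<open>(1 + \<eta>) * c q\<close> from \<open>q\<close>, or at \<open>p\<close> if that is nearer.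
  It is at \<open>q\<close> when the slack is used up, and pairs with negative slack are
  dropped.\<close>

definition tokens :: "'a::real_normed_vector set \<Rightarrow> real \<Rightarrow> ('a \<Rightarrow> real) \<Rightarrow> 'a set" where
  "tokens L \<eta> c = (\<lambda>(p, q). q + trunc ((1 + \<eta>) * c q) (p - q)) ` {(p, q) \<in> L \<times> L. 0 \<le> c q}"

context
  fixes K P :: "'a::real_normed_vector set" and w :: real
  assumes K: "compact K" "convex K" and P: "finite P" "P \<subseteq> K" "K \<subseteq> (\<Union>p\<in>P. cball p w)" and w: "0 \<le> w"
begin

lemma compact_labels: "compact (labels K P w v)"
proof -
  have "{(y, r) \<in> K \<times> P. dist y r \<le> w} = (K \<times> P) \<inter> {z. dist (fst z) (snd z) \<le> w}" by auto
  moreover have "closed {z :: 'a \<times> 'a. dist (fst z) (snd z) \<le> w}"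
    by (intro closed_Collect_le continuous_intros)
  ultimately have "compact {(y, r) \<in> K \<times> P. dist y r \<le> w}"
    using K P by (simp add: compact_Int_closed compact_Times finite_imp_compact)
  then show ?thesis unfolding labels_def case_prod_unfold
    by (intro compact_continuous_image continuous_intros)
qed

lemma net_subset_labels: "P \<subseteq> labels K P w v"
proof
  fix r assume "r \<in> P"
  then have "(r, r) \<in> {(y, r) \<in> K \<times> P. dist y r \<le> w}" using P w by auto
  then have "(\<lambda>(y, r). (1 - v) *\<^sub>R y + v *\<^sub>R r) (r, r) \<in> labels K P w v"
    unfolding labels_def by (rule imageI)
  then show "r \<in> labels K P w v" by (simp flip: scaleR_add_left)
qed

lemma labels_subset: "0 \<le> v \<Longrightarrow> v \<le> 1 \<Longrightarrow> labels K P w v \<subseteq> K"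
  using K P by (auto simp: labels_def intro!: convexD)

lemma labels_0: "labels K P w 0 = K"
proof (intro equalityI subsetI)
  fix y assume y: "y \<in> K"
  then obtain r where "r \<in> P" "dist y r \<le> w" using P(3) by (auto simp: dist_commute)
  then have "(y, r) \<in> {(y, r) \<in> K \<times> P. dist y r \<le> w}" using y by simp
  then have "(\<lambda>(y, r). (1 - 0) *\<^sub>R y + 0 *\<^sub>R r) (y, r) \<in> labels K P w 0"
    unfolding labels_def by (rule imageI)
  then show "y \<in> labels K P w 0" by simp
qed (use labels_subset[of 0] in auto)

lemma labels_1: "labels K P w 1 \<subseteq> P"
  by (auto simp: labels_def)

lemma labels_move:
  assumes "p \<in> labels K P w v"
  shows "\<exists>p'\<in>labels K P w v'. dist p p' \<le> \<bar>v - v'\<bar> * w"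
proof -
  obtain y r where yr: "(y, r) \<in> {(y, r) \<in> K \<times> P. dist y r \<le> w}" "p = (1 - v) *\<^sub>R y + v *\<^sub>R r"
    using assms unfolding labels_def by (auto simp del: mem_Collect_eq)
  define p' where "p' = (1 - v') *\<^sub>R y + v' *\<^sub>R r"
  have "p' \<in> labels K P w v'" unfolding labels_def p'_def using imageI[OF yr(1)] by force
  moreover have "p - p' = (v' - v) *\<^sub>R (y - r)" by (simp add: yr(2) p'_def algebra_simps)
  then have "dist p p' = \<bar>v - v'\<bar> * dist y r" by (simp add: dist_norm abs_minus_commute)
  then have "dist p p' \<le> \<bar>v - v'\<bar> * w" using yr(1) by (auto intro: mult_left_mono)
  ultimately show ?thesis by blast
qed

end

lemma compact_tokens:
  assumes "compact L" "continuous_on UNIV c" "0 \<le> \<eta>"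
  shows "compact (tokens L \<eta> c)"
proof -
  have cont: "continuous_on A (\<lambda>z. c (snd z))" for A :: "('a \<times> 'a) set"
    by (rule continuous_on_compose2[OF assms(2)]) (auto intro: continuous_intros)
  have "{(p, q) \<in> L \<times> L. 0 \<le> c q} = (L \<times> L) \<inter> {z. 0 \<le> c (snd z)}" by auto
  then have "compact {(p, q) \<in> L \<times> L. 0 \<le> c q}"
    using assms(1) by (simp add: compact_Int_closed compact_Times closed_Collect_le cont)
  then show ?thesis unfolding tokens_def case_prod_unfold
    using assms(3) by (intro compact_continuous_image continuous_intros continuous_on_trunc cont) auto
qed

lemma finite_tokens: "finite L \<Longrightarrow> finite (tokens L \<eta> c)"
  unfolding tokens_def by (rule finite_imageI, rule finite_subset[of _ "L \<times> L"]) auto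

lemma tokensE:
  assumes "z \<in> tokens L \<eta> c"
  obtains p q where "p \<in> L" "q \<in> L" "0 \<le> c q" "z = q + trunc ((1 + \<eta>) * c q) (p - q)"
  using assms by (auto simp: tokens_def)

lemma tokensI:
  assumes "p \<in> L" "q \<in> L" "0 \<le> c q"
  shows "q + trunc ((1 + \<eta>) * c q) (p - q) \<in> tokens L \<eta> c"
  using assms unfolding tokens_def by force

lemma label_in_tokens: "0 \<le> \<eta> \<Longrightarrow> r \<in> L \<Longrightarrow> 0 \<le> c r \<Longrightarrow> r \<in> tokens L \<eta> c"
  using tokensI[of r L r c \<eta>] by simp

lemma tokens_subset:
  assumes "convex K" "L \<subseteq> K" "0 \<le> \<eta>" shows "tokens L \<eta> c \<subseteq> K"
proof
  fix z assume "z \<in> tokens L \<eta> c"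
  then obtain p q where pq: "p \<in> L" "q \<in> L" "0 \<le> c q" "z = q + trunc ((1 + \<eta>) * c q) (p - q)"
    by (rule tokensE)
  obtain t where t: "0 \<le> t" "t \<le> 1" "trunc ((1 + \<eta>) * c q) (p - q) = t *\<^sub>R (p - q)"
    using trunc_scaleR[of "(1 + \<eta>) * c q" "p - q"] pq(3) assms(3) by auto
  then have "z = (1 - t) *\<^sub>R q + t *\<^sub>R p" using pq(4) by (simp add: algebra_simps)
  then show "z \<in> K" using convexD[OF assms(1), of q p "1 - t" t] pq assms(2) t by auto
qed

text \<open>A token on its way from \<open>p\<close> to \<open>q\<close> moves only when the distance of \<open>q\<close> to the set forces it to,
  at \<open>1 + \<eta>\<close> times the speed of the set. When the set leaves \<open>q\<close> behind, the token is at \<open>q\<close> and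
  sets out for a label \<open>r\<close> close to the set; by \<open>(2 + \<eta>) \<omega> \<le> \<eta> D'\<close> it still has to start from \<open>q\<close>.\<close>

lemma tokens_covered:
  fixes A A' :: "'a::real_normed_vector set" and D D' :: real
  defines "c \<equiv> \<lambda>q. D - infdist q A" and "c' \<equiv> \<lambda>q. D' - infdist q A'"
  assumes \<eta>: "0 < \<eta>" and A': "compact A'" "A' \<noteq> {}"
    and move: "\<And>p. p \<in> L \<Longrightarrow> \<exists>p'\<in>L'. dist p p' \<le> \<zeta>"
    and change: "\<And>q. \<bar>c q - c' q\<bar> \<le> \<kappa>"
    and net: "\<And>a. a \<in> A' \<Longrightarrow> \<exists>r\<in>L'. dist r a \<le> \<omega>"
    and \<omega>: "0 \<le> \<omega>" "(2 + \<eta>) * \<omega> \<le> \<eta> * D'"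
  shows "covered_within ((1 + \<eta>) * (\<kappa> + \<zeta>) + 5 * \<zeta>) (tokens L \<eta> c) (tokens L' \<eta> c')"
proof (rule covered_withinI)
  fix z assume "z \<in> tokens L \<eta> c"
  then obtain p q where pq: "p \<in> L" "q \<in> L" "0 \<le> c q" "z = q + trunc ((1 + \<eta>) * c q) (p - q)"
    by (rule tokensE)
  obtain p' where p': "p' \<in> L'" "dist p p' \<le> \<zeta>" using move[OF pq(1)] by blast
  obtain q' where q': "q' \<in> L'" "dist q q' \<le> \<zeta>" using move[OF pq(2)] by blast
  have \<zeta>: "0 \<le> \<zeta>" using q'(2) zero_le_dist[of q q'] by linarith
  have "\<bar>c' q - c' q'\<bar> \<le> dist q q'"
    using infdist_triangle[of q A' q'] infdist_triangle[of q' A' q] by (auto simp: c'_def dist_commute abs_if)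
  then have cc: "\<bar>c q - c' q'\<bar> \<le> \<kappa> + \<zeta>" using change[of q] q'(2) by linarith
  define S where "S = \<kappa> + \<zeta>"
  show "\<exists>z'\<in>tokens L' \<eta> c'. dist z z' \<le> (1 + \<eta>) * (\<kappa> + \<zeta>) + 5 * \<zeta>"
  proof (cases "0 \<le> c' q'")
    case True
    define z' where "z' = q' + trunc ((1 + \<eta>) * c' q') (p' - q')"
    have "z' \<in> tokens L' \<eta> c'" unfolding z'_def using p'(1) q'(1) True by (rule tokensI)
    moreover have "dist z z' \<le> (1 + \<eta>) * (\<kappa> + \<zeta>) + 5 * \<zeta>"
    proof -
      have "norm ((p - q) - (p' - q')) \<le> dist p p' + dist q q'"
        using norm_triangle_ineq4[of "p - p'" "q - q'"] by (simp add: dist_norm algebra_simps)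
      then have 1: "norm ((p - q) - (p' - q')) \<le> 2 * \<zeta>" using p' q' by linarith
      have "\<bar>(1 + \<eta>) * c q - (1 + \<eta>) * c' q'\<bar> = (1 + \<eta>) * \<bar>c q - c' q'\<bar>"
        using \<eta> by (simp add: abs_mult flip: right_diff_distrib)
      also have "\<dots> \<le> (1 + \<eta>) * (\<kappa> + \<zeta>)" using cc \<eta> by (intro mult_left_mono) auto
      finally have 2: "\<bar>(1 + \<eta>) * c q - (1 + \<eta>) * c' q'\<bar> \<le> (1 + \<eta>) * (\<kappa> + \<zeta>)" .
      \<comment> \<open>The summand \<open>5 * \<zeta>\<close> arises here: \<open>\<zeta>\<close>
        from \<open>q\<close>, and \<open>4 * \<zeta>\<close> from \<open>p - q\<close>, which moves
        by at most \<open>2 * \<zeta>\<close> and is doubled by truncation.\<close>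
      have "dist z z' \<le> dist q q' + norm (trunc ((1 + \<eta>) * c q) (p - q) - trunc ((1 + \<eta>) * c' q') (p' - q'))"
        unfolding pq(4) z'_def
        by (metis dist_norm dist_triangle_add)
      also have "norm (trunc ((1 + \<eta>) * c q) (p - q) - trunc ((1 + \<eta>) * c' q') (p' - q'))
          \<le> \<bar>(1 + \<eta>) * c q - (1 + \<eta>) * c' q'\<bar> + 2 * norm ((p - q) - (p' - q'))"
        using \<eta> pq(3) True by (intro norm_trunc_diff_le) auto
      finally show ?thesis using 1 2 q' by linarith
    qed
    ultimately show ?thesis by blast
  next
    case False
    have cS: "c q \<le> S" "- c' q' \<le> S - c q" using cc False by (auto simp: S_def)
    \<comment> \<open>The slack of \<open>q'\<close> is negative, so \<open>c q \<le> S\<close> and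
      the old token is near \<open>q\<close>. A label \<open>r\<close> near a nearest point of
      \<open>A'\<close> has slack at least \<open>D' - \<omega>\<close>, and the token of the pair
      \<open>(q', r)\<close> serves as companion.\<close>
    obtain a where a: "a \<in> A'" "infdist q' A' = dist q' a" using compact_infdist_attained[OF A'] by metis
    obtain r where r: "r \<in> L'" "dist r a \<le> \<omega>" using net[OF a(1)] by blast
    have "infdist r A' \<le> \<omega>" using infdist_le[OF a(1), of r] r(2) by linarith
    then have cr: "D' - \<omega> \<le> c' r" by (simp add: c'_def)
    have "\<eta> * \<omega> \<le> (2 + \<eta>) * \<omega>" using \<omega> by (intro mult_right_mono) auto
    then have "\<eta> * \<omega> \<le> \<eta> * D'" using \<omega>(2) by linarith
    then have "\<omega> \<le> D'" using \<eta> by simp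
    then have cr0: "0 \<le> c' r" using cr by linarith
    define z' where "z' = r + trunc ((1 + \<eta>) * c' r) (q' - r)"
    have "z' \<in> tokens L' \<eta> c'" unfolding z'_def using q'(1) r(1) cr0 by (rule tokensI)
    moreover have "dist z z' \<le> (1 + \<eta>) * (\<kappa> + \<zeta>) + 5 * \<zeta>"
    proof -
      have "q' - z' = (q' - r) - trunc ((1 + \<eta>) * c' r) (q' - r)" by (simp add: z'_def)
      then have "dist q' z' = max 0 (dist q' r - (1 + \<eta>) * c' r)"
        using norm_diff_trunc[of "(1 + \<eta>) * c' r" "q' - r"] \<eta> cr0
        unfolding dist_norm by (metis add_nonneg_nonneg less_imp_le mult_nonneg_nonneg zero_le_one)
      moreover have "dist q' r \<le> D' + (S - c q) + \<omega>"
        using dist_triangle[of q' r a] a(2) r(2) cS by (simp add: c'_def dist_commute)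
      moreover have "(1 + \<eta>) * (D' - \<omega>) \<le> (1 + \<eta>) * c' r" using cr \<eta> by (intro mult_left_mono) auto
      \<comment> \<open>By the assumption on \<open>\<omega>\<close> this is at most 0, so the reach
        \<open>(1 + \<eta>) * c' r\<close> covers \<open>dist q' r\<close> up to
        \<open>S - c q\<close>.\<close>
      moreover have "D' + \<omega> - (1 + \<eta>) * (D' - \<omega>) = (2 + \<eta>) * \<omega> - \<eta> * D'" by (simp add: algebra_simps)
      ultimately have "dist q' z' \<le> S - c q" using \<omega>(2) cS(1) by linarith
      moreover have "dist z q \<le> (1 + \<eta>) * c q"
        using norm_trunc_le[of "(1 + \<eta>) * c q" "p - q"] \<eta> pq by (simp add: dist_norm)
      moreover have "dist z z' \<le> dist z q + dist q q' + dist q' z'"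
        using dist_triangle[of z z' q] dist_triangle[of q z' q'] by linarith
      ultimately have "dist z z' \<le> (1 + \<eta>) * c q + \<zeta> + (S - c q)" using q'(2) by linarith
      also have "\<dots> = \<eta> * c q + \<zeta> + S" by (simp add: algebra_simps)
      also have "\<dots> \<le> \<eta> * S + \<zeta> + S" using cS(1) \<eta> by simp
      also have "\<dots> \<le> (1 + \<eta>) * S + 5 * \<zeta>" using \<zeta> by (simp add: algebra_simps)
      finally show ?thesis by (simp add: S_def)
    qed
    ultimately show ?thesis by blast
  qed
qed

text \<open>The map is changed in two layers around \<open>K\<close>. Up to distance
  \<open>\<rho> / 2\<close> the labels are deformed from the finite net to all of \<open>K\<close>,
  with lag bound \<open>D0\<close>; from \<open>\<rho> / 2\<close> to \<open>\<rho>\<close> the lag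
  bound falls to 0. With all of \<open>K\<close> as labels and no lag, the tokens are the points of
  \<open>A x\<close>, so the construction joins \<open>A\<close>.\<close>

lemma finite_valued_near_compact:
  fixes C :: "'a::real_normed_vector set"
  assumes A: "set_lipschitz k C A" "0 \<le> k" "k < 1"
    and K: "compact K" "convex K" "K \<noteq> {}" "K \<subseteq> C"
    and \<rho>: "0 < \<rho>" "\<And>x. \<lbrakk>x \<in> C; infdist x K \<le> \<rho>\<rbrakk> \<Longrightarrow> A x \<subseteq> K" and e: "0 < e"
  obtains l G where "0 \<le> l" "l < 1" "set_lipschitz l C G" "set_close e C A G"
    "\<And>x. x \<in> K \<Longrightarrow> G x \<subseteq> K \<and> finite (G x)"
proof -
  \<comment> \<open>The final constant is \<open>k + 2 * \<eta>\<close>: one \<open>\<eta>\<close>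
    absorbs the speed factor, as \<open>\<eta> * k \<le> \<eta>\<close>, the other the deformations,
    of total slope \<open>w * Q / \<rho>\<close>. \<open>Q\<close> collects their coefficients in
    \<open>B\<close>, and \<open>N * w\<close> bounds the displacement of the values.\<close>
  define \<eta> where "\<eta> = (1 - k) / 4"
  have \<eta>: "0 < \<eta>" "\<eta> \<le> 1" using A by (auto simp: \<eta>_def)
  define M where "M = (2 + \<eta>) / \<eta>"
  have M: "0 \<le> M" "2 + \<eta> = \<eta> * M" using \<eta> by (auto simp: M_def)
  define Q where "Q = (1 + \<eta>) * (2 * M + 2) + 10"
  have Q: "0 < Q" using \<eta> M by (auto simp: Q_def intro!: add_nonneg_pos mult_nonneg_nonneg)
  define N where "N = (1 + \<eta>) * M + 1"
  have N: "0 < N" using \<eta> M by (auto simp: N_def intro!: add_nonneg_pos mult_nonneg_nonneg)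
  define w where "w = min (\<eta> * \<rho> / Q) (e / N)"
  have w: "0 < w" "w * Q \<le> \<eta> * \<rho>" "w * N \<le> e"
    using \<eta> \<rho> e Q N by (auto simp: w_def min_def field_simps)
  define D0 where "D0 = M * w"
  have D0: "0 \<le> D0" "(2 + \<eta>) * w = \<eta> * D0" using M w by (auto simp: D0_def)
  have D0e: "(1 + \<eta>) * D0 + w \<le> e" using w(3) by (simp add: D0_def N_def algebra_simps)
  obtain P where P: "finite P" "P \<subseteq> K" "K \<subseteq> (\<Union>p\<in>P. cball p w)"
    using compact_finite_net[OF K(1) w(1)] .
  note lab = K(1,2) P less_imp_le[OF w(1)]
  define s where "s x = infdist x K" for x
  have s_lip: "\<bar>s x - s y\<bar> \<le> dist x y" for x y
    using infdist_triangle[of x K y] infdist_triangle[of y K x] by (auto simp: s_def dist_commute abs_if)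
  define D where "D x = D0 * max 0 (min 1 (2 - 2 * s x / \<rho>))" for x
  define v where "v x = max 0 (1 - 2 * s x / \<rho>)" for x
  have s0: "0 \<le> s x" for x by (simp add: s_def infdist_nonneg)
  have v: "0 \<le> v x" "v x \<le> 1" for x using s0[of x] \<rho> by (auto simp: v_def)
  have D: "0 \<le> D x" "D x \<le> D0" for x using D0 by (auto simp: D_def intro: mult_left_le)
  have near: "s x < \<rho> / 2" if "0 < v x" for x
  proof -
    have "2 * s x / \<rho> < 1" using that by (simp add: v_def)
    then show ?thesis using \<rho>(1) by (simp add: field_simps)
  qed
  have D_near: "D x = D0" if "s x < \<rho> / 2" for x
  proof -
    have "1 \<le> 2 - 2 * s x / \<rho>" using that \<rho> by (simp add: field_simps)
    then show ?thesis by (simp add: D_def)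
  qed
  have D_far: "D x = 0" if "\<rho> \<le> s x" for x
  proof -
    have "2 - 2 * s x / \<rho> \<le> 0" using that \<rho> by (simp add: field_simps)
    then show ?thesis by (simp add: D_def)
  qed
  have slope: "\<bar>2 * s x / \<rho> - 2 * s y / \<rho>\<bar> \<le> 2 * dist x y / \<rho>" for x y
  proof -
    have "\<bar>2 * s x - 2 * s y\<bar> \<le> 2 * dist x y" using s_lip[of x y] by linarith
    then have "\<bar>2 * s x - 2 * s y\<bar> / \<rho> \<le> 2 * dist x y / \<rho>"
      using \<rho>(1) by (intro divide_right_mono) auto
    moreover have "\<bar>2 * s x / \<rho> - 2 * s y / \<rho>\<bar> = \<bar>2 * s x - 2 * s y\<bar> / \<rho>"
      using \<rho>(1) by (simp flip: diff_divide_distrib)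
    ultimately show ?thesis by simp
  qed
  have v_lip: "\<bar>v x - v y\<bar> * w \<le> 2 * w / \<rho> * dist x y" for x y
  proof -
    have "\<bar>v x - v y\<bar> \<le> 2 * dist x y / \<rho>" using slope[of x y] unfolding v_def by linarith
    then have "\<bar>v x - v y\<bar> * w \<le> 2 * dist x y / \<rho> * w" using w by (intro mult_right_mono) auto
    then show ?thesis by (simp add: mult_ac)
  qed
  have D_lip: "\<bar>D x - D y\<bar> \<le> 2 * D0 / \<rho> * dist x y" for x y
  proof -
    have "\<bar>D x - D y\<bar> = D0 * \<bar>max 0 (min 1 (2 - 2 * s x / \<rho>)) - max 0 (min 1 (2 - 2 * s y / \<rho>))\<bar>"
      using D0(1) by (simp add: D_def abs_mult flip: right_diff_distrib)
    also have "\<dots> \<le> D0 * (2 * dist x y / \<rho>)"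
      using slope[of x y] D0(1) by (intro mult_left_mono) linarith+
    finally show ?thesis by (simp add: mult_ac)
  qed
  define c where "c x q = D x - infdist q (A x)" for x q
  define L where "L x = labels K P w (v x)" for x
  have L_K: "L x \<subseteq> K" for x unfolding L_def using labels_subset[OF lab v[of x]] .
  \<comment> \<open>Labels filling \<open>K\<close> leave no gap. A positive gap occurs only within
    \<open>\<rho> / 2\<close> of \<open>K\<close>, where \<open>D x = D0\<close>; hence the
    condition of \<open>tokens_covered\<close> holds even where \<open>D x\<close> vanishes.\<close>
  define \<omega> where "\<omega> x = (if v x = 0 then 0 else w)" for x
  have \<omega>: "0 \<le> \<omega> x" "\<omega> x \<le> w" "(2 + \<eta>) * \<omega> x \<le> \<eta> * D x" for x
    using w near[of x] D_near[of x] D0 v[of x] D[of x] \<eta> by (auto simp: \<omega>_def)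
  have net: "\<exists>r\<in>L x. dist r a \<le> \<omega> x" if "a \<in> K" for a x
  proof (cases "v x = 0")
    case True
    then show ?thesis using labels_0[OF lab] that by (auto simp: L_def \<omega>_def)
  next
    case False
    obtain r where "r \<in> P" "a \<in> cball r w" using subsetD[OF P(3) \<open>a \<in> K\<close>] by blast
    then have "r \<in> P" "dist r a \<le> w" by auto
    then show ?thesis using net_subset_labels[OF lab, of "v x"] False unfolding L_def \<omega>_def by auto
  qed
  define G where "G x = (if s x < \<rho> then tokens (L x) \<eta> (c x) else A x)" for x
  note Ax = set_lipschitzD[OF A(1)]
  have A_K: "A x \<subseteq> K" if "x \<in> C" "s x < \<rho>" for x using \<rho>(2)[of x] that by (simp add: s_def)
  have near_token: "\<exists>z\<in>tokens (L x) \<eta> (c x). dist a z \<le> \<omega> x" if x: "x \<in> C" "s x < \<rho>" "a \<in> A x" for x a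
  proof -
    obtain r where r: "r \<in> L x" "dist r a \<le> \<omega> x" using net[of a x] A_K[OF x(1,2)] x(3) by blast
    have "infdist r (A x) \<le> \<omega> x" using infdist_le[OF x(3), of r] r(2) by linarith
    moreover have "\<omega> x \<le> D x"
    proof -
      have "\<eta> * \<omega> x \<le> (2 + \<eta>) * \<omega> x" using \<omega>(1) by (intro mult_right_mono) auto
      then have "\<eta> * \<omega> x \<le> \<eta> * D x" using \<omega>(3)[of x] by linarith
      then show ?thesis using \<eta> by simp
    qed
    ultimately have "0 \<le> c x r" by (simp add: c_def)
    then have "r \<in> tokens (L x) \<eta> (c x)" using r \<eta> by (intro label_in_tokens) auto
    then show ?thesis using r by (auto simp: dist_commute)
  qed
  define l where "l = (k + 1) / 2"
  have l: "0 \<le> l" "l < 1" using A by (auto simp: l_def)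
  have c_change: "\<bar>c x q - c y q\<bar> \<le> (k + 2 * D0 / \<rho>) * dist x y" if "x \<in> C" "y \<in> C" for x y q
  proof -
    have "infdist q (A y) \<le> infdist q (A x) + k * dist x y"
      using infdist_covered_within[OF Ax(4)[OF that] Ax(2)[OF that(1)]] .
    moreover have "infdist q (A x) \<le> infdist q (A y) + k * dist x y"
      using infdist_covered_within[OF Ax(4)[OF that(2,1)] Ax(2)[OF that(2)]] by (simp add: dist_commute)
    ultimately show ?thesis using D_lip[of x y] by (simp add: c_def distrib_right)
  qed
  define B where "B = (1 + \<eta>) * (k + 2 * D0 / \<rho> + 2 * w / \<rho>) + 5 * (2 * w / \<rho>)"
  have "B = (1 + \<eta>) * k + w * Q / \<rho>" using \<rho>(1) by (simp add: B_def Q_def D0_def field_simps)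
  also have "\<dots> \<le> (1 + \<eta>) * k + \<eta>" using w(2) \<rho>(1) by (simp add: field_simps)
  also have "\<dots> \<le> l"
  proof -
    have "\<eta> * k \<le> \<eta>" using \<eta> A by (simp add: mult_left_le)
    moreover have "l = k + 2 * \<eta>" by (simp add: l_def \<eta>_def field_simps)
    ultimately show ?thesis by (simp add: distrib_right)
  qed
  finally have Bl: "B \<le> l" .
  have covered: "covered_within (l * dist x y) (G x) (G y)" if xy: "x \<in> C" "y \<in> C" for x y
  proof -
    define h where "h = dist x y"
    have h: "0 \<le> h" by (simp add: h_def)
    have "covered_within (B * h) (G x) (G y)"
    proof (cases "s x < \<rho>"; cases "s y < \<rho>")
      assume in_in: "s x < \<rho>" "s y < \<rho>"
      have "covered_within ((1 + \<eta>) * ((k + 2 * D0 / \<rho>) * h + 2 * w / \<rho> * h) + 5 * (2 * w / \<rho> * h))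
        (tokens (L x) \<eta> (c x)) (tokens (L y) \<eta> (c y))"
        unfolding c_def
      proof (rule tokens_covered[OF \<eta>(1) Ax(1,2)[OF xy(2)]])
        show "\<exists>p'\<in>L y. dist p p' \<le> 2 * w / \<rho> * h" if "p \<in> L x" for p
          using labels_move[OF lab, of p "v x" "v y"] v_lip[of x y] that
          unfolding L_def h_def by (meson order_trans)
        show "\<bar>D x - infdist q (A x) - (D y - infdist q (A y))\<bar> \<le> (k + 2 * D0 / \<rho>) * h" for q
          using c_change[OF xy, of q] by (simp add: c_def h_def)
        show "\<exists>r\<in>L y. dist r a \<le> \<omega> y" if "a \<in> A y" for a
          using net A_K[OF xy(2) in_in(2)] that by blast
      qed (use \<omega> in auto)
      moreover have "(1 + \<eta>) * ((k + 2 * D0 / \<rho>) * h + 2 * w / \<rho> * h) + 5 * (2 * w / \<rho> * h) = B * h"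
        by (simp add: B_def algebra_simps)
      ultimately show ?thesis using in_in by (simp add: G_def)
    next
      assume in_out: "s x < \<rho>" "\<not> s y < \<rho>"
      show ?thesis
      proof (rule covered_withinI)
        fix z assume "z \<in> G x"
        then have "z \<in> tokens (L x) \<eta> (c x)" using in_out by (simp add: G_def)
        then obtain p q where pq: "p \<in> L x" "q \<in> L x" "0 \<le> c x q"
          "z = q + trunc ((1 + \<eta>) * c x q) (p - q)" by (rule tokensE)
        obtain a where a: "a \<in> A y" "infdist q (A y) = dist q a"
          using compact_infdist_attained[OF Ax(1,2)[OF xy(2)]] by metis
        define \<kappa> where "\<kappa> = (k + 2 * D0 / \<rho>) * h"
        \<comment> \<open>As \<open>D y = 0\<close>, the slack at \<open>y\<close> is minus the
          distance of \<open>q\<close> to \<open>A y\<close>, so a bound on the change of slack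
          bounds that distance.\<close>
        have "- c y q = dist q a" using a D_far[of y] in_out by (simp add: c_def)
        then have qa: "dist q a \<le> \<kappa> - c x q"
          using c_change[OF xy, of q] by (simp add: \<kappa>_def h_def)
        then have c\<kappa>: "c x q \<le> \<kappa>" using zero_le_dist[of q a] by linarith
        have "dist z q \<le> (1 + \<eta>) * c x q"
          using norm_trunc_le[of "(1 + \<eta>) * c x q" "p - q"] \<eta> pq by (simp add: dist_norm)
        then have "dist z a \<le> (1 + \<eta>) * c x q + (\<kappa> - c x q)"
          using dist_triangle[of z a q] qa by linarith
        also have "\<dots> = \<eta> * c x q + \<kappa>" by (simp add: algebra_simps)
        also have "\<dots> \<le> \<eta> * \<kappa> + \<kappa>" using c\<kappa> \<eta> by simp
        also have "\<dots> = (1 + \<eta>) * \<kappa>" by (simp add: distrib_right)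
        also have "\<dots> = (1 + \<eta>) * (k + 2 * D0 / \<rho>) * h" by (simp only: \<kappa>_def mult.assoc)
        also have "\<dots> \<le> B * h"
          unfolding B_def using w \<rho> \<eta> h by (intro mult_right_mono) (auto simp: distrib_left)
        finally show "\<exists>b\<in>G y. dist z b \<le> B * h" using a in_out by (auto simp: G_def)
      qed
    next
      assume out_in: "\<not> s x < \<rho>" "s y < \<rho>"
      show ?thesis
      proof (rule covered_withinI)
        fix a assume "a \<in> G x"
        then have "a \<in> A x" using out_in by (simp add: G_def)
        then obtain a' where a': "a' \<in> A y" "dist a a' \<le> k * h"
          using Ax(4)[OF xy] by (auto simp: h_def elim: covered_withinE)
        obtain z where z: "z \<in> tokens (L y) \<eta> (c y)" "dist a' z \<le> \<omega> y"
          using near_token[OF xy(2) out_in(2) a'(1)] by blast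
        \<comment> \<open>A positive gap puts \<open>y\<close> within \<open>\<rho> / 2\<close> of
          \<open>K\<close> while \<open>x\<close> is at least \<open>\<rho>\<close> away, so
          \<open>h \<ge> \<rho> / 2\<close> pays for the gap \<open>w\<close>.\<close>
        have "\<omega> y \<le> 2 * w / \<rho> * h"
        proof (cases "v y = 0")
          case False
          then have "s y < \<rho> / 2" using near[of y] v[of y] by simp
          then have "\<rho> / 2 \<le> h" using out_in s_lip[of x y] by (simp add: h_def)
          then show ?thesis using False \<rho>(1) w by (simp add: \<omega>_def field_simps)
        qed (use w \<rho> h in \<open>simp add: \<omega>_def\<close>)
        then have "dist a z \<le> k * h + 2 * w / \<rho> * h" using dist_triangle[of a z a'] a' z by linarith
        also have "\<dots> = (k + 2 * w / \<rho>) * h" by (simp add: algebra_simps)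
        also have "\<dots> \<le> B * h"
        proof (intro mult_right_mono h)
          have "0 \<le> \<eta> * (k + 2 * D0 / \<rho> + 2 * w / \<rho>)" "0 \<le> 2 * D0 / \<rho>" "0 \<le> 2 * w / \<rho>"
            using \<eta> A D0 w \<rho> by auto
          then show "k + 2 * w / \<rho> \<le> B" unfolding B_def by (simp add: distrib_right)
        qed
        finally show "\<exists>b\<in>G y. dist a b \<le> B * h" using z out_in by (auto simp: G_def)
      qed
    next
      assume out_out: "\<not> s x < \<rho>" "\<not> s y < \<rho>"
      have "0 \<le> \<eta> * (k + 2 * D0 / \<rho> + 2 * w / \<rho>)" "0 \<le> 2 * D0 / \<rho>" "0 \<le> 2 * w / \<rho>"
        using \<eta> A D0 w \<rho> by auto
      then have "k \<le> B" unfolding B_def by (simp add: distrib_right)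
      then have "k * h \<le> B * h" using h by (rule mult_right_mono)
      then show ?thesis using out_out Ax(4)[OF xy] covered_within_mono
        by (auto simp: G_def h_def)
    qed
    moreover have "B * h \<le> l * h" using Bl h by (rule mult_right_mono)
    ultimately show ?thesis unfolding h_def by (rule covered_within_mono)
  qed
  have "set_lipschitz l C G"
    unfolding set_lipschitz_def nonempty_compacts_def
  proof (intro conjI ballI CollectI)
    fix x assume x: "x \<in> C"
    show "G x \<subseteq> C"
    proof (cases "s x < \<rho>")
      case True
      then show ?thesis using tokens_subset[OF K(2) L_K, of \<eta>] K(4) \<eta> by (auto simp: G_def)
    qed (use Ax x in \<open>simp add: G_def\<close>)
    show "G x \<noteq> {}"
    proof (cases "s x < \<rho>")
      case True
      obtain a where "a \<in> A x" using Ax(2)[OF x] by blast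
      then show ?thesis using near_token[OF x True] True by (auto simp: G_def)
    qed (use Ax x in \<open>simp add: G_def\<close>)
    show "compact (G x)"
    proof (cases "s x < \<rho>")
      case True
      have "compact (tokens (L x) \<eta> (c x))"
        unfolding c_def L_def using \<eta>
        by (intro compact_tokens compact_labels[OF lab] continuous_intros) auto
      then show ?thesis using True by (simp add: G_def)
    qed (use Ax x in \<open>simp add: G_def\<close>)
  qed (rule covered)
  moreover have "set_close e C A G"
    unfolding set_close_def
  proof (intro ballI conjI covered_withinI)
    fix x a assume x: "x \<in> C" "a \<in> A x"
    show "\<exists>b\<in>G x. dist a b \<le> e"
    proof (cases "s x < \<rho>")
      case True
      have "0 \<le> (1 + \<eta>) * D0" using \<eta> D0 by auto
      then have "\<omega> x \<le> e" using \<omega>(2)[of x] D0e by linarith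
      then show ?thesis using near_token[OF x(1) True x(2)] True by (force simp: G_def)
    qed (use x e in \<open>auto simp: G_def intro!: bexI[of _ a]\<close>)
  next
    fix x z assume x: "x \<in> C" "z \<in> G x"
    show "\<exists>b\<in>A x. dist z b \<le> e"
    proof (cases "s x < \<rho>")
      case True
      then have "z \<in> tokens (L x) \<eta> (c x)" using x by (simp add: G_def)
      then obtain p q where pq: "p \<in> L x" "q \<in> L x" "0 \<le> c x q"
        "z = q + trunc ((1 + \<eta>) * c x q) (p - q)" by (rule tokensE)
      obtain a where a: "a \<in> A x" "infdist q (A x) = dist q a"
        using compact_infdist_attained[OF Ax(1,2)[OF x(1)]] by metis
      have "dist z q \<le> (1 + \<eta>) * c x q"
        using norm_trunc_le[of "(1 + \<eta>) * c x q" "p - q"] \<eta> pq by (simp add: dist_norm)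
      then have "dist z a \<le> (1 + \<eta>) * c x q + dist q a" using dist_triangle[of z a q] by linarith
      also have "\<dots> \<le> (1 + \<eta>) * (c x q + dist q a)" using \<eta> by (simp add: algebra_simps)
      also have "\<dots> = (1 + \<eta>) * D x" using a by (simp add: c_def)
      also have "\<dots> \<le> (1 + \<eta>) * D0" using D \<eta> by (intro mult_left_mono) auto
      finally show ?thesis using a D0e w by force
    qed (use x e in \<open>auto simp: G_def intro!: bexI[of _ z]\<close>)
  qed
  moreover have "G x \<subseteq> K \<and> finite (G x)" if x: "x \<in> K" for x
  proof -
    have s: "s x = 0" using x by (simp add: s_def)
    then have "G x = tokens (L x) \<eta> (c x)" using \<rho> by (simp add: G_def)
    moreover have "finite (L x)"
      unfolding L_def using s finite_subset[OF labels_1[OF lab] P(1)] by (simp add: v_def)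
    ultimately show ?thesis using tokens_subset[OF K(2) L_K, of \<eta>] finite_tokens \<eta> by simp
  qed
  ultimately show thesis using that l by blast
qed

lemma finite_valued_approximation:
  fixes C :: "'a::banach set"
  assumes F: "F \<in> nonexpansive_maps C"
    and C: "closed C" "convex C" "bounded C" "x0 \<in> C" and e: "0 < e"
  obtains l G K where "0 \<le> l" "l < 1" "set_lipschitz l C G" "set_close e C F G"
    "compact K" "convex K" "x0 \<in> K" "K \<subseteq> C" "\<And>x. x \<in> K \<Longrightarrow> G x \<subseteq> K \<and> finite (G x)"
proof -
  \<comment> \<open>The thirds of \<open>e\<close> go to the homothety, the retraction and the
    tokens. The summand 1 keeps the denominator positive when \<open>diameter C = 0\<close>.\<close>
  define t where "t = min (1 / 2) (e / 3 / (diameter C + 1))"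
  have dC: "0 \<le> diameter C" using C by (simp add: diameter_ge_0)
  have t: "0 < t" "t < 1" "t * diameter C \<le> e / 3"
  proof -
    show "0 < t" "t < 1" using e dC by (auto simp: t_def)
    have "t * diameter C \<le> e / 3 / (diameter C + 1) * (diameter C + 1)"
      using dC e by (intro mult_mono) (auto simp: t_def)
    also have "\<dots> = e / 3" using dC by (intro nonzero_divide_eq_eq[THEN iffD1, symmetric] refl) auto
    finally show "t * diameter C \<le> e / 3" .
  qed
  note F1 = nonexpansive_imp_set_lipschitz[OF F]
  define H where "H x = (\<lambda>a. (1 - t) *\<^sub>R a + t *\<^sub>R x0) ` F x" for x
  have H: "set_lipschitz (1 - t) C H" "set_close (t * diameter C) C F H"
    unfolding H_def
    using set_lipschitz_homothety[OF F1 C(2,4)] set_close_homothety[OF F1 C(3,4)] t by auto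
  have k: "0 \<le> 1 - t" "1 - t < 1" using t by auto
  obtain K where K: "compact K" "convex K" "x0 \<in> K" "K \<subseteq> C" "\<And>x. x \<in> K \<Longrightarrow> H x \<subseteq> K"
    using compact_convex_invariant_set[OF H(1) k C] by metis
  have "K \<noteq> {}" using K by blast
  have e3: "0 < e / 3" using e by simp
  obtain T \<rho> where T: "0 < \<rho>" "set_lipschitz (1 + t) C T" "\<And>x. T x \<subseteq> cball x (e / 3)"
    "\<And>x. infdist x K \<le> \<rho> \<Longrightarrow> T x \<subseteq> K"
    using multivalued_retraction[OF K(1,2) \<open>K \<noteq> {}\<close> K(4) C(2) e3 t(1)] by metis
  define A where "A x = (\<Union>u\<in>T x. H u)" for x
  \<comment> \<open>The retraction has constant \<open>1 + t\<close> so that the product with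
    \<open>1 - t\<close> stays below 1.\<close>
  have A: "set_lipschitz ((1 - t) * (1 + t)) C A"
    unfolding A_def by (rule set_lipschitz_compose[OF H(1) k(1) T(2)])
  have kk: "0 \<le> (1 - t) * (1 + t)" "(1 - t) * (1 + t) < 1"
    using t by (simp_all add: algebra_simps mult_le_one)
  have HA: "set_close (e / 3) C H A"
    unfolding set_close_def
  proof (intro ballI conjI covered_withinI)
    fix x a assume x: "x \<in> C" "a \<in> H x"
    obtain u where u: "u \<in> T x" using set_lipschitzD(2)[OF T(2) x(1)] by blast
    then have "u \<in> C" "dist x u \<le> e / 3" using set_lipschitzD(3)[OF T(2) x(1)] T(3)[of x] by auto
    then obtain b where b: "b \<in> H u" "dist a b \<le> (1 - t) * dist x u"
      using set_lipschitzD(4)[OF H(1) x(1)] x(2) by (meson covered_withinE)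
    have "(1 - t) * dist x u \<le> 1 * (e / 3)"
      using t \<open>dist x u \<le> e / 3\<close> by (intro mult_mono) auto
    with b have "dist a b \<le> e / 3" "b \<in> A x" using u by (auto simp: A_def)
    then show "\<exists>b\<in>A x. dist a b \<le> e / 3" ..
  next
    fix x b assume x: "x \<in> C" "b \<in> A x"
    then obtain u where u: "u \<in> T x" "b \<in> H u" by (auto simp: A_def)
    then have "u \<in> C" "dist x u \<le> e / 3" using set_lipschitzD(3)[OF T(2) x(1)] T(3)[of x] by auto
    then obtain a where "a \<in> H x" "dist b a \<le> (1 - t) * dist u x"
      using set_lipschitzD(4)[OF H(1) _ x(1)] u(2) by (meson covered_withinE)
    moreover have "(1 - t) * dist u x \<le> 1 * (e / 3)"
      using t \<open>dist x u \<le> e / 3\<close> by (intro mult_mono) (auto simp: dist_commute)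
    ultimately show "\<exists>a\<in>H x. dist b a \<le> e / 3" by force
  qed
  have A_K: "A x \<subseteq> K" if "x \<in> C" "infdist x K \<le> \<rho>" for x
    using T(4)[OF that(2)] K(5) by (auto simp: A_def)
  obtain l G where G: "0 \<le> l" "l < 1" "set_lipschitz l C G" "set_close (e / 3) C A G"
    "\<And>x. x \<in> K \<Longrightarrow> G x \<subseteq> K \<and> finite (G x)"
    using finite_valued_near_compact[OF A kk K(1,2) \<open>K \<noteq> {}\<close> K(4) T(1) A_K e3] by metis
  have "set_close (t * diameter C + e / 3 + e / 3) C F G"
    by (rule set_close_trans[OF set_close_trans[OF H(2) HA] G(4)])
  then have "set_close e C F G" by (rule set_close_mono) (use t in linarith)
  then show thesis using that G(1-3,5) K(1-4) by blast
qed

section \<open>Stability and uniqueness of finite trajectories\<close>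

lemma metric_proj_nonempty:
  assumes "compact A" "A \<noteq> {}" shows "metric_proj A x \<noteq> {}"
  using compact_infdist_attained[OF assms, of x] by (metis (mono_tags) empty_iff mem_Collect_eq metric_proj_def)

lemma metric_projD: "y \<in> metric_proj A x \<Longrightarrow> y \<in> A \<and> dist x y = infdist x A"
  by (simp add: metric_proj_def)

text \<open>By uniqueness and compactness, points of \<open>A\<close> at distance at least
  \<open>e / 2\<close> from \<open>y\<close> are farther from \<open>x\<close> than
  \<open>infdist x A\<close> by some \<open>\<gamma>\<close>. A nearest point for the perturbed data
  has a companion in \<open>A\<close> that misses the minimum by less than \<open>\<gamma>\<close>,
  hence lies near \<open>y\<close>.\<close>

lemma projection_stable:
  fixes x :: "'a::metric_space"
  assumes A: "compact A" and y: "metric_proj A x = {y}" and e: "0 < e"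
  obtains s where "0 < s" "s \<le> e"
    "\<And>x' B b. \<lbrakk>dist x' x \<le> s; covered_within s A B; covered_within s B A; b \<in> metric_proj B x'\<rbrakk>
      \<Longrightarrow> dist b y \<le> e"
proof -
  have yA: "y \<in> A" using y metric_projD[of y A x] by auto
  define Z where "Z = A - ball y (e / 2)"
  have Z: "compact Z" unfolding Z_def by (rule compact_diff[OF A open_ball])
  obtain \<gamma> where \<gamma>: "0 < \<gamma>" "\<And>a. a \<in> Z \<Longrightarrow> infdist x A + \<gamma> \<le> dist x a"
  proof (cases "Z = {}")
    case True
    then show thesis using that[of 1] by simp
  next
    case False
    obtain z where z: "z \<in> Z" "infdist x Z = dist x z" using compact_infdist_attained[OF Z False] .
    have "z \<in> A" "z \<noteq> y" using z(1) e by (auto simp: Z_def)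
    then have "dist x z \<noteq> infdist x A" using y by (auto simp: metric_proj_def)
    then have "infdist x A < dist x z" using infdist_le[OF \<open>z \<in> A\<close>, of x] by simp
    moreover have "dist x z \<le> dist x a" if "a \<in> Z" for a using infdist_le[OF that, of x] z(2) by simp
    ultimately show thesis using that[of "dist x z - infdist x A"] by simp
  qed
  \<comment> \<open>The perturbations below add up to \<open>4 * s\<close>; the fifth
    \<open>s\<close> makes the comparison with \<open>\<gamma>\<close> strict.\<close>
  define s where "s = min (e / 2) (\<gamma> / 5)"
  have s: "0 < s" "s \<le> e / 2" "5 * s \<le> \<gamma>" using e \<gamma> by (auto simp: s_def)
  show thesis
  proof (rule that)
    show "0 < s" "s \<le> e" using s e by auto
  next
    fix x' B b
    assume x': "dist x' x \<le> s" and B: "covered_within s A B" "covered_within s B A"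
      and "b \<in> metric_proj B x'"
    then have b: "b \<in> B" "dist x' b = infdist x' B" using metric_projD by blast+
    have "infdist x' B \<le> infdist x' A + s" using infdist_covered_within[OF B(1)] yA by blast
    moreover have "infdist x' A \<le> infdist x A + dist x' x" by (rule infdist_triangle)
    moreover obtain a where a: "a \<in> A" "dist b a \<le> s" using covered_withinE[OF B(2) b(1)] .
    moreover have "dist x a \<le> dist x' x + dist x' b + dist b a"
      using dist_triangle[of x a x'] dist_triangle[of x' a b] by (simp add: dist_commute)
    ultimately have "dist x a < infdist x A + \<gamma>" using x' b s by linarith
    then have "a \<notin> Z" using \<gamma>(2)[of a] by fastforce
    then have "dist y a < e / 2" using a by (simp add: Z_def)
    then show "dist b y \<le> e" using dist_triangle[of b y a] a s by (simp add: dist_commute)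
  qed
qed

text \<open>Tolerances propagate backwards: the last projection dictates how closely step
  \<open>n\<close> must be followed, so the induction keeps \<open>e\<close> general. All nearest
  points are controlled, not only the one chosen by \<open>y\<close>, because regularity in the
  limit depends on them.\<close>

lemma trajectories_follow:
  assumes G: "set_lipschitz 1 C G" and x: "x 0 = x0" "x0 \<in> C"
    and uniq: "\<And>j. j < N \<Longrightarrow> metric_proj (G (x j)) (x j) = {x (Suc j)}" and e: "0 < e"
  obtains \<delta> where "0 < \<delta>"
    "\<And>F y. \<lbrakk>set_close \<delta> C G F; is_trajectory C F x0 y\<rbrakk> \<Longrightarrow>
      (\<forall>j\<le>N. dist (y j) (x j) \<le> e) \<and>
      (\<forall>j<N. \<forall>b\<in>metric_proj (F (y j)) (y j). dist b (x (Suc j)) \<le> e)"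
proof -
  have xC: "x j \<in> C" if "j \<le> N" for j
    using that
  proof (induction j)
    case (Suc j)
    then have "x (Suc j) \<in> G (x j)" using uniq[of j] metric_projD[of "x (Suc j)"] by auto
    then show ?case using set_lipschitzD(3)[OF G, of "x j"] Suc by auto
  qed (use x in simp)
  have "\<exists>\<delta>>0. \<forall>F y. set_close \<delta> C G F \<longrightarrow> is_trajectory C F x0 y \<longrightarrow>
      (\<forall>j\<le>n. dist (y j) (x j) \<le> e) \<and>
      (\<forall>j<n. \<forall>b\<in>metric_proj (F (y j)) (y j). dist b (x (Suc j)) \<le> e)"
    if "n \<le> N" "0 < e" for n e
    using that
  proof (induction n arbitrary: e)
    case 0
    then show ?case using x by (intro exI[of _ 1]) (simp add: is_trajectory_def)
  next
    case (Suc n)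
    have n: "n < N" "x n \<in> C" using Suc.prems xC[of n] by auto
    obtain s where s: "0 < s" "s \<le> e"
      "\<And>x' B b. \<lbrakk>dist x' (x n) \<le> s; covered_within s (G (x n)) B; covered_within s B (G (x n));
        b \<in> metric_proj B x'\<rbrakk> \<Longrightarrow> dist b (x (Suc n)) \<le> e"
      using projection_stable[OF set_lipschitzD(1)[OF G n(2)] uniq[OF n(1)] Suc.prems(2)] by blast
    obtain \<delta> where \<delta>: "0 < \<delta>" "\<And>F y. \<lbrakk>set_close \<delta> C G F; is_trajectory C F x0 y\<rbrakk> \<Longrightarrow>
      (\<forall>j\<le>n. dist (y j) (x j) \<le> s / 2) \<and>
      (\<forall>j<n. \<forall>b\<in>metric_proj (F (y j)) (y j). dist b (x (Suc j)) \<le> s / 2)"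
      using Suc.IH[of "s / 2"] n s(1) by auto
    show ?case
    proof (intro exI[of _ "min \<delta> (s / 2)"] conjI allI impI ballI)
      show "0 < min \<delta> (s / 2)" using \<delta> s by simp
      fix F y assume F: "set_close (min \<delta> (s / 2)) C G F" and y: "is_trajectory C F x0 y"
      note IH = \<delta>(2)[OF set_close_mono[OF F] y, simplified]
      have yC: "y n \<in> C" using y by (simp add: is_trajectory_def)
      have d: "dist (y n) (x n) \<le> s / 2" using IH by simp
      have FG: "covered_within (s / 2) (G (y n)) (F (y n))" "covered_within (s / 2) (F (y n)) (G (y n))"
        using set_close_mono[OF F, of "s / 2"] yC by (auto simp: set_close_def)
      have GG: "covered_within (s / 2) (G (x n)) (G (y n))" "covered_within (s / 2) (G (y n)) (G (x n))"
        using set_lipschitzD(4)[OF G n(2) yC] set_lipschitzD(4)[OF G yC n(2)] d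
        by (auto intro: covered_within_mono simp: dist_commute)
      have last: "dist b (x (Suc n)) \<le> e" if "b \<in> metric_proj (F (y n)) (y n)" for b
        using covered_within_trans[OF GG(1) FG(1)] covered_within_trans[OF FG(2) GG(2)] d s(1)
        by (intro s(3)[OF _ _ _ that]) auto
      show "dist b (x (Suc j)) \<le> e" if "j < Suc n" "b \<in> metric_proj (F (y j)) (y j)" for j b
      proof (cases "j = n")
        case False
        then have "dist b (x (Suc j)) \<le> s / 2" using IH that by auto
        then show ?thesis using s by linarith
      qed (use last that in simp)
      show "dist (y j) (x j) \<le> e" if "j \<le> Suc n" for j
      proof (cases "j = Suc n")
        case True
        then show ?thesis using last[of "y (Suc n)"] y by (simp add: is_trajectory_def)
      next
        case False
        then have "dist (y j) (x j) \<le> s / 2" using IH that by auto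
        then show ?thesis using s by linarith
      qed
    qed
  qed
  then show thesis using that e by (metis order_refl)
qed

text \<open>One nearest point \<open>a0\<close> of \<open>H u\<close> is preferred by drawing values
  towards \<open>u\<close> by a fraction that attains its maximum \<open>\<beta>\<close> only at the
  pair \<open>(u, a0)\<close>. The fraction vanishes at distance \<open>s\<close> or more from
  \<open>u\<close>, and segments towards \<open>u\<close> stay in \<open>K\<close>.\<close>

lemma tie_breaking_step:
  fixes C K :: "'a::real_normed_vector set"
  assumes H: "set_lipschitz k C H" "0 \<le> k" and C: "convex C" "bounded C"
    and K: "convex K" "K \<subseteq> C" "\<And>x. x \<in> K \<Longrightarrow> H x \<subseteq> K" and u: "u \<in> K" and e: "0 < e" "0 < s"
  obtains H' a where "set_lipschitz (k + e) C H'" "set_close e C H H'" "\<And>x. x \<in> K \<Longrightarrow> H' x \<subseteq> K"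
    "metric_proj (H' u) u = {a}" "\<And>x. s \<le> dist x u \<Longrightarrow> H' x = H x"
proof -
  have uC: "u \<in> C" using u K by blast
  note Hu = set_lipschitzD[OF H(1) uC]
  obtain a0 where a0: "a0 \<in> H u" "infdist u (H u) = dist u a0" using compact_infdist_attained[OF Hu(1,2)] .
  define d where "d = diameter C"
  have d: "0 \<le> d" "\<And>x y. \<lbrakk>x \<in> C; y \<in> C\<rbrakk> \<Longrightarrow> dist x y \<le> d"
    using C by (auto simp: d_def diameter_ge_0 diameter_bounded_bound)
  \<comment> \<open>Per unit of \<open>\<beta>\<close> the displacement is at most \<open>d\<close>
    and the increase of the Lipschitz constant at most \<open>(1 + k) / s * d\<close>;
    \<open>Q\<close> dominates both and is positive even for \<open>d = 0\<close>.\<close>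
  define Q where "Q = (1 + (1 + k) / s) * (d + 1)"
  have "0 \<le> (1 + k) / s" using e H by simp
  then have Q: "0 < Q" using d unfolding Q_def by (intro mult_pos_pos) auto
  define \<beta> where "\<beta> = min (1 / 2) (e / Q)"
  have \<beta>: "0 < \<beta>" "\<beta> \<le> 1 / 2" "\<beta> * Q \<le> e" using e Q by (auto simp: \<beta>_def min_def field_simps)
  have "0 \<le> (1 + k) / s" "0 \<le> (1 + k) / s * d" using e H d by auto
  moreover have "Q = d + (1 + k) / s * d + 1 + (1 + k) / s" unfolding Q_def by algebra
  ultimately have dQ: "d \<le> Q" "(1 + k) / s * d \<le> Q" using d(1) by linarith+
  have \<beta>d: "\<beta> * d \<le> e" "\<beta> * ((1 + k) / s * d) \<le> e"
    using mult_left_mono[OF dQ(1) less_imp_le[OF \<beta>(1)]] mult_left_mono[OF dQ(2) less_imp_le[OF \<beta>(1)]]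
      \<beta>(3) by linarith+
  define bump where "bump z = max 0 (1 - z / s)" for z
  have bump: "0 \<le> bump z" "0 \<le> z \<Longrightarrow> bump z \<le> 1" "bump 0 = 1" "0 < z \<Longrightarrow> bump z < 1"
    "s \<le> z \<Longrightarrow> bump z = 0" for z using e by (auto simp: bump_def)
  have bump_lip: "\<bar>bump z - bump z'\<bar> \<le> \<bar>z - z'\<bar> / s" for z z'
  proof -
    have "\<bar>bump z - bump z'\<bar> \<le> \<bar>z / s - z' / s\<bar>" unfolding bump_def by linarith
    then show ?thesis using e by (simp flip: diff_divide_distrib)
  qed
  define g where "g x a = \<beta> * (bump (dist x u) * bump (dist a a0))" for x a
  have bump01: "0 \<le> bump (dist x y)" "bump (dist x y) \<le> 1" for x y :: 'a using bump(1,2) by auto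
  have g: "0 \<le> g x a" "g x a \<le> \<beta>" for x a
  proof -
    have "bump (dist x u) * bump (dist a a0) \<le> 1" using bump01 by (intro mult_le_one) auto
    then show "g x a \<le> \<beta>" using \<beta> by (simp add: g_def mult_left_le)
    show "0 \<le> g x a" using \<beta> bump01 by (simp add: g_def)
  qed
  have g_lip: "\<bar>g x a - g y b\<bar> \<le> \<beta> * ((dist x y + dist a b) / s)" for x y a b
  proof -
    have "\<bar>bump (dist x u) * bump (dist a a0) - bump (dist y u) * bump (dist b a0)\<bar>
      = \<bar>bump (dist x u) * (bump (dist a a0) - bump (dist b a0))
        + (bump (dist x u) - bump (dist y u)) * bump (dist b a0)\<bar>" by (simp add: algebra_simps)
    also have "\<dots> \<le> bump (dist x u) * \<bar>bump (dist a a0) - bump (dist b a0)\<bar>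
        + \<bar>bump (dist x u) - bump (dist y u)\<bar> * bump (dist b a0)"
      using bump01 by (intro abs_triangle_ineq[THEN order_trans]) (simp add: abs_mult)
    also have "\<dots> \<le> 1 * \<bar>bump (dist a a0) - bump (dist b a0)\<bar> + \<bar>bump (dist x u) - bump (dist y u)\<bar> * 1"
      using bump01 by (intro add_mono mult_mono) auto
    also have "\<dots> \<le> \<bar>dist a a0 - dist b a0\<bar> / s + \<bar>dist x u - dist y u\<bar> / s"
      using bump_lip by (simp add: add_mono)
    also have "\<dots> \<le> dist a b / s + dist x y / s"
      using e dist_triangle[of a a0 b] dist_triangle[of b a0 a] dist_triangle[of x u y] dist_triangle[of y u x]
      by (intro add_mono divide_right_mono) (auto simp: abs_le_iff dist_commute)
    finally have "\<bar>bump (dist x u) * bump (dist a a0) - bump (dist y u) * bump (dist b a0)\<bar>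
      \<le> (dist x y + dist a b) / s" by (simp add: add_divide_distrib)
    then have "\<beta> * \<bar>bump (dist x u) * bump (dist a a0) - bump (dist y u) * bump (dist b a0)\<bar>
      \<le> \<beta> * ((dist x y + dist a b) / s)" using \<beta>(1) by (intro mult_left_mono) auto
    then show ?thesis using \<beta>(1) by (simp add: g_def abs_mult flip: right_diff_distrib)
  qed
  define f where "f x a = a + g x a *\<^sub>R (u - a)" for x a
  define H' where "H' x = f x ` H x" for x
  have f_conv: "f x a = (1 - g x a) *\<^sub>R a + g x a *\<^sub>R u" for x a by (simp add: f_def algebra_simps)
  have f_in: "f x a \<in> S" if "convex S" "a \<in> S" "u \<in> S" for x a S
    unfolding f_conv using that g[of x a] \<beta> by (intro convexD) auto
  have close: "dist a (f x a) \<le> e" if "a \<in> C" for x a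
  proof -
    have "dist a (f x a) = g x a * dist u a" using g[of x a] by (simp add: f_def dist_norm)
    also have "\<dots> \<le> \<beta> * d" using g[of x a] d(2)[OF uC that] by (intro mult_mono) (use \<beta> in auto)
    finally show ?thesis using \<beta>d by linarith
  qed
  have "set_lipschitz (k + e) C H'"
  proof (rule set_lipschitzI)
    fix x assume x: "x \<in> C"
    note Hx = set_lipschitzD[OF H(1) x]
    have "continuous_on (H x) (f x)" unfolding f_def g_def bump_def
      using e by (intro continuous_intros) auto
    then show "compact (H' x)" unfolding H'_def by (intro compact_continuous_image Hx(1))
    show "H' x \<noteq> {}" using Hx by (simp add: H'_def)
    show "H' x \<subseteq> C" using Hx f_in[OF C(1) _ uC] by (auto simp: H'_def)
  next
    fix x y c assume xy: "x \<in> C" "y \<in> C" and "c \<in> H' x"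
    then obtain a where a: "a \<in> H x" "c = f x a" by (auto simp: H'_def)
    obtain b where b: "b \<in> H y" "dist a b \<le> k * dist x y"
      using covered_withinE[OF set_lipschitzD(4)[OF H(1) xy] a(1)] .
    have bC: "b \<in> C" using b set_lipschitzD(3)[OF H(1) xy(2)] by blast
    have "f x a - f y b = (1 - g x a) *\<^sub>R (a - b) + (g x a - g y b) *\<^sub>R (u - b)"
      by (simp add: f_def algebra_simps)
    then have "dist (f x a) (f y b) \<le> norm ((1 - g x a) *\<^sub>R (a - b)) + norm ((g x a - g y b) *\<^sub>R (u - b))"
      unfolding dist_norm by (simp only: norm_triangle_ineq)
    also have "\<dots> = (1 - g x a) * dist a b + \<bar>g x a - g y b\<bar> * dist u b"
      using g[of x a] \<beta> by (simp add: dist_norm)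
    also have "\<dots> \<le> 1 * (k * dist x y) + \<beta> * ((dist x y + dist a b) / s) * d"
      using g[of x a] \<beta> b g_lip[of x a y b] d(2)[OF uC bC]
      by (intro add_mono mult_mono) (auto intro!: mult_nonneg_nonneg divide_nonneg_nonneg simp: less_imp_le[OF e(2)])
    also have "\<beta> * ((dist x y + dist a b) / s) * d \<le> \<beta> * (((1 + k) * dist x y) / s) * d"
      using b \<beta> d e by (intro mult_right_mono mult_left_mono divide_right_mono) (auto simp: algebra_simps)
    also have "\<dots> = \<beta> * ((1 + k) / s * d) * dist x y" by simp
    also have "\<dots> \<le> e * dist x y" using \<beta>d(2) by (intro mult_right_mono) auto
    finally have "dist (f x a) (f y b) \<le> (k + e) * dist x y" by (simp add: algebra_simps)
    then show "\<exists>b\<in>H' y. dist c b \<le> (k + e) * dist x y" using a b by (auto simp: H'_def)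
  qed
  moreover have "set_close e C H H'"
    unfolding set_close_def
  proof (intro ballI conjI covered_withinI)
    fix x a assume "x \<in> C" "a \<in> H x"
    then show "\<exists>b\<in>H' x. dist a b \<le> e"
      using close[of a x] set_lipschitzD(3)[OF H(1)] by (intro bexI[of _ "f x a"]) (auto simp: H'_def)
  next
    fix x b assume x: "x \<in> C" "b \<in> H' x"
    then obtain a where a: "a \<in> H x" "b = f x a" by (auto simp: H'_def)
    then show "\<exists>a\<in>H x. dist b a \<le> e"
      using close[of a x] set_lipschitzD(3)[OF H(1) x(1)] by (intro bexI[of _ a]) (auto simp: dist_commute)
  qed
  moreover have "H' x \<subseteq> K" if "x \<in> K" for x
    using K(3)[OF that] f_in[OF K(1) _ u] by (auto simp: H'_def)
  moreover have "H' x = H x" if "s \<le> dist x u" for x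
    using bump(5)[OF that] by (simp add: H'_def f_def g_def)
  moreover have "metric_proj (H' u) u = {f u a0}"
  proof -
    have du: "dist u (f u a) = (1 - g u a) * dist u a" for a
    proof -
      have "u - f u a = (1 - g u a) *\<^sub>R (u - a)" by (simp add: f_def algebra_simps)
      then show ?thesis using g[of u a] \<beta> by (simp add: dist_norm)
    qed
    have gu: "g u a0 = \<beta>" using bump by (simp add: g_def)
    have ge: "(1 - \<beta>) * dist u a0 \<le> (1 - g u a) * dist u a" if "a \<in> H u" for a
      using g[of u a] \<beta> a0(2) infdist_le[OF that, of u] by (intro mult_mono) auto
    have inf: "infdist u (H' u) = (1 - \<beta>) * dist u a0"
    proof (rule antisym)
      show "infdist u (H' u) \<le> (1 - \<beta>) * dist u a0"
        using infdist_le[of "f u a0" "H' u" u] a0 du[of a0] gu by (simp add: H'_def)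
      have "H' u \<noteq> {}" using a0 by (auto simp: H'_def)
      then show "(1 - \<beta>) * dist u a0 \<le> infdist u (H' u)"
        unfolding infdist_notempty[OF \<open>H' u \<noteq> {}\<close>]
        using ge du by (intro cINF_greatest) (auto simp: H'_def)
    qed
    have uniq: "a = a0" if a: "a \<in> H u" "(1 - g u a) * dist u a = (1 - \<beta>) * dist u a0" for a
    proof (rule ccontr)
      assume "a \<noteq> a0"
      then have "bump (dist a a0) < 1" using bump(4) by simp
      then have less: "g u a < \<beta>" using bump(3) \<beta> by (simp add: g_def)
      have le: "dist u a0 \<le> dist u a" using a0(2) infdist_le[OF a(1), of u] by simp
      show False
      proof (cases "dist u a0 = 0")
        case True
        then have "dist u a = 0" using a(2) less \<beta> by simp
        then show False using True \<open>a \<noteq> a0\<close> by simp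
      next
        case False
        then have "(1 - \<beta>) * dist u a0 < (1 - g u a) * dist u a0"
          using less by (intro mult_strict_right_mono) auto
        also have "\<dots> \<le> (1 - g u a) * dist u a" using le less \<beta> by (intro mult_left_mono) auto
        finally show False using a(2) by simp
      qed
    qed
    show ?thesis
    proof (intro equalityI subsetI)
      fix z assume "z \<in> metric_proj (H' u) u"
      then have z: "z \<in> H' u" "dist u z = (1 - \<beta>) * dist u a0" by (simp_all add: metric_proj_def inf)
      then obtain a where a: "a \<in> H u" "z = f u a" unfolding H'_def by blast
      then show "z \<in> {f u a0}" using uniq[OF a(1)] z(2) du[of a] by simp
    next
      fix z assume "z \<in> {f u a0}"
      then have "z \<in> H' u" "dist u z = (1 - \<beta>) * dist u a0"
        using a0(1) du[of a0] gu by (simp_all add: H'_def)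
      then show "z \<in> metric_proj (H' u) u" by (simp add: metric_proj_def inf)
    qed
  qed
  ultimately show thesis using that by blast
qed

text \<open>Ties are broken in the order of the trajectory. If it returns to an earlier point, the
  nearest point there is already unique; otherwise the correction is confined to a ball missing all
  earlier points and leaves their values unchanged.\<close>

lemma tie_breaking:
  fixes C K :: "'a::real_normed_vector set"
  assumes G: "set_lipschitz l C G" "0 \<le> l" and C: "convex C" "bounded C"
    and K: "convex K" "K \<subseteq> C" "x0 \<in> K" "\<And>x. x \<in> K \<Longrightarrow> G x \<subseteq> K" and e: "0 < e"
  shows "\<exists>H x. set_lipschitz (l + e) C H \<and> set_close e C G H \<and> (\<forall>x\<in>K. H x \<subseteq> K) \<and> x 0 = x0 \<and>
    (\<forall>j\<le>N. x j \<in> K) \<and> (\<forall>j<N. metric_proj (H (x j)) (x j) = {x (Suc j)})"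
  using e
proof (induction N arbitrary: e)
  case 0
  have "set_close e C G G" using 0 by (force simp: set_close_def covered_within_def)
  moreover have "set_lipschitz (l + e) C G" by (rule set_lipschitz_mono[OF G(1)]) (use 0 in simp)
  ultimately show ?case using K by (intro exI[of _ G] exI[of _ "\<lambda>_. x0"]) simp
next
  case (Suc N)
  then obtain H x where H: "set_lipschitz (l + e / 2) C H" "set_close (e / 2) C G H" "\<forall>x\<in>K. H x \<subseteq> K"
    and x: "x 0 = x0" "\<forall>j\<le>N. x j \<in> K" "\<forall>j<N. metric_proj (H (x j)) (x j) = {x (Suc j)}"
    by (metis half_gt_zero)
  show ?case
  proof (cases "\<exists>i<N. x i = x N")
    case True
    then obtain i where i: "i < N" "x i = x N" by blast
    define x' where "x' = x(Suc N := x (Suc i))"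
    have "\<forall>j\<le>Suc N. x' j \<in> K" using x(2) i(1) by (auto simp: x'_def le_Suc_eq)
    moreover have "\<forall>j<Suc N. metric_proj (H (x' j)) (x' j) = {x' (Suc j)}"
      using x(3) i by (auto simp: x'_def less_Suc_eq)
    moreover have "set_lipschitz (l + e) C H" "set_close e C G H"
      using set_lipschitz_mono[OF H(1)] set_close_mono[OF H(2)] Suc.prems by auto
    ultimately show ?thesis using H(3) x(1) by (intro exI[of _ H] exI[of _ x']) (simp add: x'_def)
  next
    case False
    \<comment> \<open>The element 1 makes the minimum meaningful for \<open>N = 0\<close>.\<close>
    define s where "s = Min (insert 1 ((\<lambda>i. dist (x i) (x N)) ` {..<N}))"
    have s: "0 < s" "\<And>i. i < N \<Longrightarrow> s \<le> dist (x i) (x N)"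
      using False by (auto simp: s_def)
    have e2: "0 < e / 2" "0 \<le> l + e / 2" "x N \<in> K" using Suc.prems G(2) x(2) by auto
    obtain H' a where H': "set_lipschitz (l + e / 2 + e / 2) C H'" "set_close (e / 2) C H H'"
      "\<And>x. x \<in> K \<Longrightarrow> H' x \<subseteq> K" "metric_proj (H' (x N)) (x N) = {a}"
      "\<And>y. s \<le> dist y (x N) \<Longrightarrow> H' y = H y"
      using tie_breaking_step[OF H(1) e2(2) C K(1,2) _ e2(3,1) s(1)] H(3) by metis
    define x' where "x' = x(Suc N := a)"
    have "a \<in> K" using H'(3)[OF e2(3)] H'(4) metric_projD[of a] by blast
    then have "\<forall>j\<le>Suc N. x' j \<in> K" using x(2) by (auto simp: x'_def le_Suc_eq)
    moreover have "\<forall>j<Suc N. metric_proj (H' (x' j)) (x' j) = {x' (Suc j)}"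
      using x(3) H'(4) H'(5)[OF s(2)] by (auto simp: x'_def less_Suc_eq)
    moreover have "set_close e C G H'" using set_close_trans[OF H(2) H'(2)] by simp
    moreover have "set_lipschitz (l + e) C H'" using H'(1) by (simp add: add.commute)
    ultimately show ?thesis using H'(3) x(1) by (intro exI[of _ H'] exI[of _ x']) (simp add: x'_def)
  qed
qed

text \<open>The point \<open>x (Suc j)\<close> lies in \<open>H (x j)\<close>, so its distance to
  \<open>H (x (Suc j))\<close> is at most \<open>l\<close> times the step length, which is the
  previous residual.\<close>

lemma residual_decay:
  assumes H: "set_lipschitz l C H" "0 \<le> l" and C: "bounded C"
    and x: "\<And>j. j \<le> N \<Longrightarrow> x j \<in> C" "\<And>j. j < N \<Longrightarrow> x (Suc j) \<in> metric_proj (H (x j)) (x j)"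
  shows "infdist (x N) (H (x N)) \<le> l ^ N * diameter C"
  using x
proof (induction N)
  case 0
  then have x0: "x 0 \<in> C" by simp
  obtain b where "b \<in> H (x 0)" "b \<in> C" using set_lipschitzD(2,3)[OF H(1) x0] by blast
  then show ?case
    using infdist_le[of b "H (x 0)" "x 0"] diameter_bounded_bound[OF C x0, of b] by simp
next
  case (Suc N)
  have xN: "x N \<in> C" "x (Suc N) \<in> C" using Suc.prems(1) by auto
  have p: "x (Suc N) \<in> H (x N)" "dist (x N) (x (Suc N)) = infdist (x N) (H (x N))"
    using metric_projD[OF Suc.prems(2)[of N]] by auto
  have "infdist (x (Suc N)) (H (x (Suc N))) \<le> infdist (x (Suc N)) (H (x N)) + l * dist (x N) (x (Suc N))"
    by (rule infdist_covered_within[OF set_lipschitzD(4)[OF H(1) xN] set_lipschitzD(2)[OF H(1) xN(1)]])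
  also have "\<dots> = l * infdist (x N) (H (x N))" using p by simp
  also have "\<dots> \<le> l * (l ^ N * diameter C)"
    using Suc H(2) by (intro mult_left_mono) auto
  finally show ?case by (simp add: mult_ac)
qed

section \<open>Traps and the category argument\<close>

text \<open>For \<open>x\<close> in the ball, \<open>G x\<close> has a point near \<open>c\<close>,
  so a nearest point \<open>b\<close> of \<open>F x\<close> is within \<open>3 * r\<close> of
  \<open>c\<close>. It is also within \<open>l * r + \<delta> = r\<close> of some point of
  \<open>G c\<close>, and isolation forces that point to be \<open>c\<close>.\<close>

lemma trap_at_isolated_fixed_point:
  fixes C :: "'a::metric_space set"
  assumes G: "set_lipschitz l C G" "0 \<le> l" "l < 1" and c: "c \<in> C" "c \<in> G c" "finite (G c)" and e: "0 < e"
  obtains r \<delta> where "0 < r" "r \<le> e" "0 < \<delta>"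
    "\<And>F x b. \<lbrakk>set_close \<delta> C G F; x \<in> C; dist x c \<le> r; b \<in> metric_proj (F x) x\<rbrakk> \<Longrightarrow> dist b c \<le> r"
proof -
  obtain g where g: "0 < g" "\<forall>a\<in>G c. a \<noteq> c \<longrightarrow> g \<le> dist c a"
    using finite_set_avoid[OF c(3)] by blast
  \<comment> \<open>The point of \<open>G c\<close> found below is within \<open>4 * r\<close> of
    \<open>c\<close>, hence strictly within the isolation gap \<open>g\<close>.\<close>
  define r where "r = min e (g / 8)"
  define \<delta> where "\<delta> = (1 - l) * r"
  have r: "0 < r" "r \<le> e" "8 * r \<le> g" using e g by (auto simp: r_def)
  have \<delta>: "0 < \<delta>" "l * r + \<delta> = r" using r G by (auto simp: \<delta>_def algebra_simps)
  show thesis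
  proof (rule that[OF r(1,2) \<delta>(1)])
    fix F x b assume F: "set_close \<delta> C G F" and x: "x \<in> C" "dist x c \<le> r" and "b \<in> metric_proj (F x) x"
    then have b: "b \<in> F x" "dist x b = infdist x (F x)" using metric_projD by blast+
    have FG: "covered_within \<delta> (G x) (F x)" "covered_within \<delta> (F x) (G x)"
      using F x by (auto simp: set_close_def)
    have lr: "l * dist x c \<le> l * r" "l * dist c x \<le> l * r"
      using x G by (auto intro: mult_left_mono simp: dist_commute)
    obtain a1 where a1: "a1 \<in> G x" "dist c a1 \<le> l * dist c x"
      using covered_withinE[OF set_lipschitzD(4)[OF G(1) c(1) x(1)] c(2)] .
    obtain b1 where b1: "b1 \<in> F x" "dist a1 b1 \<le> \<delta>" using covered_withinE[OF FG(1) a1(1)] .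
    have "dist x b \<le> dist x b1" using infdist_le[OF b1(1), of x] b by simp
    also have "\<dots> \<le> dist x c + dist c a1 + dist a1 b1"
      using dist_triangle[of x b1 c] dist_triangle[of c b1 a1] by linarith
    also have "\<dots> \<le> 2 * r" using x a1 b1 lr \<delta> by linarith
    finally have bc: "dist b c \<le> 3 * r"
      using dist_triangle[of b c x] x by (simp add: dist_commute)
    obtain a2 where a2: "a2 \<in> G x" "dist b a2 \<le> \<delta>" using covered_withinE[OF FG(2) b(1)] .
    obtain a3 where a3: "a3 \<in> G c" "dist a2 a3 \<le> l * dist x c"
      using covered_withinE[OF set_lipschitzD(4)[OF G(1) x(1) c(1)] a2(1)] .
    have ba3: "dist b a3 \<le> r" using dist_triangle[of b a3 a2] a2 a3 lr \<delta> by linarith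
    then have "dist c a3 \<le> 4 * r" using dist_triangle[of c a3 b] bc by (simp add: dist_commute)
    then have "dist c a3 < g" using r by linarith
    then have "a3 = c" using g(2) a3(1) by force
    then show "dist b c \<le> r" using ba3 by simp
  qed
qed

text \<open>At a fixed point in \<open>K\<close>, finiteness of the value gives a trap; near any
  other point of \<open>K\<close> the residual is bounded away from 0 and the claim is vacuous. A
  finite subcover makes the constants uniform.\<close>

lemma uniform_traps:
  fixes C K :: "'a::metric_space set"
  assumes G: "set_lipschitz l C G" "0 \<le> l" "l < 1" and K: "compact K" "K \<subseteq> C" "\<And>x. x \<in> K \<Longrightarrow> finite (G x)"
    and e: "0 < e"
  obtains \<sigma> \<delta> where "0 < \<sigma>" "0 < \<delta>"
    "\<And>x. \<lbrakk>x \<in> K; infdist x (G x) < \<sigma>\<rbrakk> \<Longrightarrow> \<exists>c r. dist x c < r \<and> r \<le> e \<and>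
      (\<forall>F y b. set_close \<delta> C G F \<longrightarrow> y \<in> C \<longrightarrow> dist y c \<le> r \<longrightarrow> b \<in> metric_proj (F y) y \<longrightarrow> dist b c \<le> r)"
proof -
  define trap where "trap \<delta> c r \<longleftrightarrow> r \<le> e \<and> (\<forall>F y b. set_close \<delta> C G F \<longrightarrow> y \<in> C \<longrightarrow> dist y c \<le> r \<longrightarrow>
    b \<in> metric_proj (F y) y \<longrightarrow> dist b c \<le> r)" for \<delta> c r
  have "\<exists>t>0. \<forall>x\<in>C. dist x c < t \<longrightarrow> infdist x (G x) < t \<longrightarrow> (\<exists>r. dist x c < r \<and> trap t c r)"
    if c: "c \<in> K" for c
  proof (cases "c \<in> G c")
    case True
    have cC: "c \<in> C" using c K by blast
    obtain r \<delta> where r: "0 < r" "r \<le> e" "0 < \<delta>"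
      "\<And>F x b. \<lbrakk>set_close \<delta> C G F; x \<in> C; dist x c \<le> r; b \<in> metric_proj (F x) x\<rbrakk> \<Longrightarrow> dist b c \<le> r"
      using trap_at_isolated_fixed_point[OF G cC True K(3)[OF c] e] by metis
    have "trap (min r \<delta>) c r" unfolding trap_def
      using r set_close_mono[of "min r \<delta>" C G _ \<delta>] by auto
    then show ?thesis using r by (intro exI[of _ "min r \<delta>"]) auto
  next
    case False
    have cC: "c \<in> C" using c K by blast
    define t where "t = infdist c (G c) / 3"
    have "infdist c (G c) \<noteq> 0"
      using False set_lipschitzD(1,2)[OF G(1) cC] in_closed_iff_infdist_zero compact_imp_closed by blast
    then have t: "0 < t" using infdist_nonneg[of c "G c"] by (simp add: t_def)
    have "\<not> infdist x (G x) < t" if x: "x \<in> C" "dist x c < t" for x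
    proof -
      have "infdist c (G c) \<le> infdist c (G x) + l * dist x c"
        by (rule infdist_covered_within[OF set_lipschitzD(4)[OF G(1) x(1) cC] set_lipschitzD(2)[OF G(1) x(1)]])
      also have "infdist c (G x) \<le> infdist x (G x) + dist c x" by (rule infdist_triangle)
      also have "l * dist x c \<le> 1 * dist x c" using G by (intro mult_right_mono) auto
      finally show ?thesis using x by (simp add: t_def dist_commute)
    qed
    then show ?thesis using t by blast
  qed
  then obtain t where t: "\<And>c. c \<in> K \<Longrightarrow> 0 < t c"
    "\<And>c x. \<lbrakk>c \<in> K; x \<in> C; dist x c < t c; infdist x (G x) < t c\<rbrakk> \<Longrightarrow> \<exists>r. dist x c < r \<and> trap (t c) c r"
    by metis
  have "K \<subseteq> (\<Union>c\<in>K. ball c (t c))" using t(1) by force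
  then obtain I where I: "I \<subseteq> K" "finite I" "K \<subseteq> (\<Union>c\<in>I. ball c (t c))"
    by (rule compactE_image[OF K(1), rotated]) auto
  define \<sigma> where "\<sigma> = Min (insert 1 (t ` I))"
  have \<sigma>: "0 < \<sigma>" "\<And>c. c \<in> I \<Longrightarrow> \<sigma> \<le> t c" using I t(1) by (auto simp: \<sigma>_def)
  show thesis
  proof (rule that[OF \<sigma>(1) \<sigma>(1)])
    fix x assume x: "x \<in> K" "infdist x (G x) < \<sigma>"
    obtain c where c: "c \<in> I" "x \<in> ball c (t c)" using subsetD[OF I(3) x(1)] by blast
    have "infdist x (G x) < t c" using x(2) \<sigma>(2)[OF c(1)] by linarith
    moreover have "dist x c < t c" using c(2) by (simp add: dist_commute)
    ultimately obtain r where r: "dist x c < r" "trap (t c) c r" using t(2)[of c x] c I x K by blast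
    have "set_close (t c) C G F" if "set_close \<sigma> C G F" for F
      using set_close_mono[OF that \<sigma>(2)[OF c(1)]] .
    then show "\<exists>c r. dist x c < r \<and> r \<le> e \<and> (\<forall>F y b. set_close \<sigma> C G F \<longrightarrow> y \<in> C \<longrightarrow> dist y c \<le> r \<longrightarrow>
        b \<in> metric_proj (F y) y \<longrightarrow> dist b c \<le> r)"
      using r unfolding trap_def by blast
  qed
qed

text \<open>Required for every \<open>r = 1 / (m + 1)\<close>, the two clauses become uniqueness of
  nearest points and the Cauchy property. All trajectories are quantified because a map near a given
  one may still have several.\<close>

definition settled :: "'a::metric_space set \<Rightarrow> 'a \<Rightarrow> real \<Rightarrow> ('a \<Rightarrow> 'a set) \<Rightarrow> bool" where
  "settled C x0 r F \<longleftrightarrow> (\<forall>y. is_trajectory C F x0 y \<longrightarrow>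
     (\<forall>n. \<forall>b\<in>metric_proj (F (y n)) (y n). \<forall>b'\<in>metric_proj (F (y n)) (y n). dist b b' \<le> r) \<and>
     (\<exists>N. \<forall>i\<ge>N. \<forall>j\<ge>N. dist (y i) (y j) \<le> r))"

text \<open>The order of choices matters: first traps for \<open>G\<close>, then the number
  \<open>N\<close> of steps to a small residual, then the tie-broken map \<open>H\<close>, so close
  to \<open>G\<close> that the traps still work for all maps near \<open>H\<close>.\<close>

lemma settled_near:
  fixes C :: "'a::banach set"
  assumes F: "F \<in> nonexpansive_maps C"
    and C: "closed C" "convex C" "bounded C" "x0 \<in> C" and e: "0 < e" and r: "0 < r"
  obtains G \<delta> where "set_lipschitz 1 C G" "set_close e C F G" "0 < \<delta>"
    "\<And>F'. set_close \<delta> C G F' \<Longrightarrow> settled C x0 r F'"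
proof -
  have e2: "0 < e / 2" "0 < r / 2" using e r by auto
  obtain l G K where l: "0 \<le> l" "l < 1" and G: "set_lipschitz l C G" "set_close (e / 2) C F G"
    and K: "compact K" "convex K" "x0 \<in> K" "K \<subseteq> C" "\<And>x. x \<in> K \<Longrightarrow> G x \<subseteq> K \<and> finite (G x)"
    using finite_valued_approximation[OF F C e2(1)] by metis
  have fin: "finite (G x)" "G x \<subseteq> K" if "x \<in> K" for x using K(5) that by auto
  obtain \<sigma> \<delta> where \<sigma>: "0 < \<sigma>" "0 < \<delta>"
    "\<And>x. \<lbrakk>x \<in> K; infdist x (G x) < \<sigma>\<rbrakk> \<Longrightarrow> \<exists>c \<rho>. dist x c < \<rho> \<and> \<rho> \<le> r / 2 \<and>
      (\<forall>F y b. set_close \<delta> C G F \<longrightarrow> y \<in> C \<longrightarrow> dist y c \<le> \<rho> \<longrightarrow> b \<in> metric_proj (F y) y \<longrightarrow> dist b c \<le> \<rho>)"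
    using uniform_traps[OF G(1) l K(1,4) fin(1) e2(2)] by metis
  \<comment> \<open>A rate between \<open>l\<close> and 1 that does not depend on the tie-breaking,
    so \<open>N\<close> can be fixed before \<open>H\<close>.\<close>
  define m where "m = (1 + l) / 2"
  have m: "0 \<le> m" "m < 1" using l by (auto simp: m_def)
  have "(\<lambda>n. m ^ n * diameter C) \<longlonglongrightarrow> 0 * diameter C"
    using m by (intro tendsto_intros LIMSEQ_realpow_zero)
  then have "\<forall>\<^sub>F n in sequentially. m ^ n * diameter C < \<sigma> / 2"
    using \<sigma> by (intro order_tendstoD) auto
  then obtain N where N: "m ^ N * diameter C < \<sigma> / 2" by (auto simp: eventually_sequentially)
  \<comment> \<open>The bounds keep \<open>H\<close> within \<open>e\<close> of \<open>F\<close>,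
    its Lipschitz constant at most \<open>m\<close> and the residual of \<open>G\<close> at
    \<open>x N\<close> below \<open>\<sigma>\<close>, and leave \<open>\<delta> / 2\<close> for
    perturbing \<open>H\<close>.\<close>
  define \<eta> where "\<eta> = min (min (e / 2) ((1 - l) / 2)) (min (\<sigma> / 2) (\<delta> / 2))"
  have "\<eta> \<le> (1 - l) / 2" unfolding \<eta>_def by linarith
  then have \<eta>: "0 < \<eta>" "\<eta> \<le> e / 2" "\<eta> \<le> (1 - l) / 2" "\<eta> \<le> \<sigma> / 2" "\<eta> \<le> \<delta> / 2"
    using e l \<sigma>(1,2) by (auto simp: \<eta>_def)
  obtain H x where H: "set_lipschitz (l + \<eta>) C H" "set_close \<eta> C G H" "\<forall>x\<in>K. H x \<subseteq> K"
    and x: "x 0 = x0" "\<forall>j\<le>N. x j \<in> K" "\<forall>j<N. metric_proj (H (x j)) (x j) = {x (Suc j)}"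
    using tie_breaking[OF G(1) l(1) C(2,3) K(2,4,3) fin(2) \<eta>(1), of N] by blast
  have H1: "set_lipschitz m C H" by (rule set_lipschitz_mono[OF H(1)]) (use \<eta> in \<open>simp add: m_def field_simps\<close>)
  have H2: "set_lipschitz 1 C H" by (rule set_lipschitz_mono[OF H1]) (use m in simp)
  have xN: "x N \<in> K" "x N \<in> C" using x(2) K(4) by auto
  have "infdist (x N) (H (x N)) \<le> m ^ N * diameter C"
    by (rule residual_decay[OF H1 m(1) C(3)]) (use x K(4) in auto)
  moreover have "infdist (x N) (G (x N)) \<le> infdist (x N) (H (x N)) + \<eta>"
    using H(2) xN(2) set_lipschitzD(2)[OF H1 xN(2)]
    by (intro infdist_covered_within) (auto simp: set_close_def)
  ultimately have "infdist (x N) (G (x N)) < \<sigma>" using N \<eta> by linarith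
  then obtain c \<rho> where c: "dist (x N) c < \<rho>" "\<rho> \<le> r / 2"
    "\<And>F y b. \<lbrakk>set_close \<delta> C G F; y \<in> C; dist y c \<le> \<rho>; b \<in> metric_proj (F y) y\<rbrakk> \<Longrightarrow> dist b c \<le> \<rho>"
    using \<sigma>(3)[OF xN(1)] by blast
  \<comment> \<open>The bound \<open>r / 2\<close> serves the nearest points before time
    \<open>N\<close>; the other one puts the perturbed trajectory into the trap at time
    \<open>N\<close>.\<close>
  define e' where "e' = min (r / 2) (\<rho> - dist (x N) c)"
  have "e' \<le> r / 2" unfolding e'_def by linarith
  then have e': "0 < e'" "e' \<le> r / 2" "e' \<le> \<rho> - dist (x N) c" using c(1) r by (auto simp: e'_def)
  obtain \<delta>' where \<delta>': "0 < \<delta>'" "\<And>F y. \<lbrakk>set_close \<delta>' C H F; is_trajectory C F x0 y\<rbrakk> \<Longrightarrow>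
      (\<forall>j\<le>N. dist (y j) (x j) \<le> e') \<and>
      (\<forall>j<N. \<forall>b\<in>metric_proj (F (y j)) (y j). dist b (x (Suc j)) \<le> e')"
    using trajectories_follow[of C H x x0 N e'] H2 x(1,3) C(4) e'(1) by metis
  show thesis
  proof (rule that[OF H2, of "min \<delta>' (\<delta> / 2)"])
    have "set_close (e / 2 + \<eta>) C F H" by (rule set_close_trans[OF G(2) H(2)])
    then show "set_close e C F H" by (rule set_close_mono) (use \<eta> in simp)
    show "0 < min \<delta>' (\<delta> / 2)" using \<delta>' \<sigma> by simp
    fix F' assume F': "set_close (min \<delta>' (\<delta> / 2)) C H F'"
    have "set_close (\<eta> + min \<delta>' (\<delta> / 2)) C G F'" by (rule set_close_trans[OF H(2) F'])
    then have GF: "set_close \<delta> C G F'" by (rule set_close_mono) (use \<eta> in simp)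
    have HF: "set_close \<delta>' C H F'" by (rule set_close_mono[OF F']) simp
    show "settled C x0 r F'"
      unfolding settled_def
    proof (intro allI impI conjI ballI)
      fix y assume y: "is_trajectory C F' x0 y"
      note early = \<delta>'(2)[OF HF y]
      have yC: "y n \<in> C" "y (Suc n) \<in> metric_proj (F' (y n)) (y n)" for n
        using y by (auto simp: is_trajectory_def)
      have late: "dist (y (N + n)) c \<le> \<rho>" for n
      proof (induction n)
        case 0
        have "dist (y N) (x N) \<le> e'" using early by simp
        then show ?case using dist_triangle[of "y N" c "x N"] e' by simp
      next
        case (Suc n)
        then show ?case using c(3)[OF GF yC(1) Suc yC(2)] by simp
      qed
      have late': "dist (y n) c \<le> \<rho>" if "N \<le> n" for n using late[of "n - N"] that by simp
      show "\<exists>N. \<forall>i\<ge>N. \<forall>j\<ge>N. dist (y i) (y j) \<le> r"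
      proof (intro exI[of _ N] allI impI)
        fix i j assume "N \<le> i" "N \<le> j"
        then show "dist (y i) (y j) \<le> r"
          using late'[of i] late'[of j] dist_triangle2[of "y i" "y j" c] c(2) by linarith
      qed
      fix n b b' assume b: "b \<in> metric_proj (F' (y n)) (y n)" "b' \<in> metric_proj (F' (y n)) (y n)"
      show "dist b b' \<le> r"
      proof (cases "n < N")
        case True
        then have "dist b (x (Suc n)) \<le> e'" "dist b' (x (Suc n)) \<le> e'" using early b by auto
        then show ?thesis using dist_triangle2[of b b' "x (Suc n)"] e' by linarith
      next
        case False
        then have "dist (y n) c \<le> \<rho>" using late' by simp
        then have "dist b c \<le> \<rho>" "dist b' c \<le> \<rho>" using c(3)[OF GF yC(1)] b by blast+
        then show ?thesis using dist_triangle2[of b b' c] c(2) by linarith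
      qed
    qed
  qed
qed

section \<open>Existence of trajectories and passage to the limit\<close>

lemma trajectory_exists:
  assumes F: "set_lipschitz k C F" and x0: "x0 \<in> C"
  obtains y where "is_trajectory C F x0 y"
proof -
  have "\<exists>z. z \<in> C \<and> z \<in> metric_proj (F x) x" if "x \<in> C" for x
    using metric_proj_nonempty[OF set_lipschitzD(1,2)[OF F that], of x] set_lipschitzD(3)[OF F that]
    by (auto simp: metric_proj_def)
  then obtain next_pt where nxt: "\<And>x. x \<in> C \<Longrightarrow> next_pt x \<in> C \<and> next_pt x \<in> metric_proj (F x) x" by metis
  define y where "y = rec_nat x0 (\<lambda>_. next_pt)"
  have "y n \<in> C" for n by (induction n) (use x0 nxt in \<open>auto simp: y_def\<close>)
  then have "is_trajectory C F x0 y" using nxt by (auto simp: is_trajectory_def y_def)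
  then show thesis by (rule that)
qed

lemma settled_imp_regular_convergent:
  fixes C :: "'a::banach set"
  assumes F: "F \<in> nonexpansive_maps C" and C: "closed C" "x0 \<in> C"
    and settled: "\<And>m. settled C x0 (1 / real (Suc m)) F"
  shows "\<exists>y. is_regular_trajectory C F x0 y \<and> (\<exists>c\<in>C. c \<in> F c \<and> y \<longlonglongrightarrow> c)"
proof -
  note F1 = nonexpansive_imp_set_lipschitz[OF F]
  obtain y where y: "is_trajectory C F x0 y" using trajectory_exists[OF F1 C(2)] .
  have yC: "y n \<in> C" "y (Suc n) \<in> metric_proj (F (y n)) (y n)" for n
    using y by (auto simp: is_trajectory_def)
  have "b = b'" if b: "b \<in> metric_proj (F (y n)) (y n)" "b' \<in> metric_proj (F (y n)) (y n)" for n b b'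
  proof (rule ccontr)
    assume "b \<noteq> b'"
    then obtain m where "1 / real (Suc m) < dist b b'" using nat_approx_posE[of "dist b b'"] by auto
    then show False using settled[of m] y b unfolding settled_def by force
  qed
  then have "is_singleton (metric_proj (F (y n)) (y n))" for n
    using yC(2)[of n] by (intro is_singletonI') auto
  then have reg: "is_regular_trajectory C F x0 y" using y by (simp add: is_regular_trajectory_def)
  have "Cauchy y"
  proof (rule metric_CauchyI)
    fix e :: real assume "0 < e"
    then obtain m where m: "1 / real (Suc m) < e" using nat_approx_posE by blast
    obtain N where "\<forall>i\<ge>N. \<forall>j\<ge>N. dist (y i) (y j) \<le> 1 / real (Suc m)"
      using settled[of m] y unfolding settled_def by blast
    then show "\<exists>N. \<forall>i\<ge>N. \<forall>j\<ge>N. dist (y i) (y j) < e" using m by (meson le_less_trans)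
  qed
  then obtain c where c: "y \<longlonglongrightarrow> c" using Cauchy_convergent_iff convergent_def by blast
  have cC: "c \<in> C" using closed_sequentially[OF C(1) _ c] yC by blast
  \<comment> \<open>The residual along a trajectory is the step length, which tends to 0;
    nonexpansiveness carries this over to the limit.\<close>
  have "infdist c (F c) \<le> 2 * dist (y n) c + dist (y n) (y (Suc n))" for n
  proof -
    have "infdist c (F c) \<le> infdist c (F (y n)) + 1 * dist (y n) c"
      by (rule infdist_covered_within[OF set_lipschitzD(4)[OF F1 yC(1) cC] set_lipschitzD(2)[OF F1 yC(1)]])
    also have "infdist c (F (y n)) \<le> infdist (y n) (F (y n)) + dist c (y n)" by (rule infdist_triangle)
    finally show ?thesis using metric_projD[OF yC(2)[of n]] by (simp add: dist_commute)
  qed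
  moreover have "(\<lambda>n. 2 * dist (y n) c + dist (y n) (y (Suc n))) \<longlonglongrightarrow> 2 * dist c c + dist c c"
    using c LIMSEQ_Suc[OF c] by (intro tendsto_intros)
  ultimately have "infdist c (F c) \<le> 2 * dist c c + dist c c"
    by (intro LIMSEQ_le_const) auto
  then have "infdist c (F c) = 0" using infdist_nonneg[of c "F c"] by simp
  then have "c \<in> F c"
    using in_closed_iff_infdist_zero[OF compact_imp_closed[OF set_lipschitzD(1)[OF F1 cC]] set_lipschitzD(2)[OF F1 cC]]
    by simp
  then show ?thesis using reg c cC by blast
qed

theorem corollary5p4:
  fixes C :: "'a::banach set" and x0 :: 'a
  assumes "C \<noteq> {}" and "closed C" and "convex C" and "bounded C"
    and "x0 \<in> C"
  shows "\<exists>\<F>. \<F> \<subseteq> nonexpansive_maps C \<and>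
           residual_in (nonexpansive_topology C) \<F> \<and>
           (\<forall>F\<in>\<F>. \<exists>x. is_regular_trajectory C F x0 x \<and>
              (\<exists>l\<in>C. l \<in> F l \<and> x \<longlonglongrightarrow> l))"
proof -
  define M where "M = nonexpansive_maps C"
  define X where "X = nonexpansive_topology C"
  interpret MS: Metric_space M "unif_dist C"
    unfolding M_def by (rule Metric_space_nonexpansive_maps[OF assms(4,1)])
  have X: "X = MS.mtopology" by (simp add: X_def nonexpansive_topology_def M_def)
  have topX: "topspace X = M" unfolding X by simp
  \<comment> \<open>The category argument uses density of the interior of \<open>S m\<close>;
    openness of \<open>S m\<close> is not claimed.\<close>
  define S where "S m = {F \<in> M. settled C x0 (1 / real (Suc m)) F}" for m
  have dense: "X closure_of (X interior_of S m) = M" for m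
  proof (rule antisym)
    show "X closure_of (X interior_of S m) \<subseteq> M" using closure_of_subset_topspace topX by metis
    show "M \<subseteq> X closure_of (X interior_of S m)"
    proof
      fix F assume F: "F \<in> M"
      have "\<exists>G\<in>X interior_of S m. G \<in> MS.mball F e" if e: "0 < e" for e
      proof -
        obtain G \<delta> where G: "set_lipschitz 1 C G" "set_close (e / 2) C F G" "0 < \<delta>"
          "\<And>F'. set_close \<delta> C G F' \<Longrightarrow> settled C x0 (1 / real (Suc m)) F'"
          using settled_near[of F C x0 "e / 2" "1 / real (Suc m)"] F assms(2-5) e unfolding M_def by auto
        \<comment> \<open>Elements of \<open>M\<close> have the value \<open>undefined\<close> off
          \<open>C\<close>; closeness is tested on \<open>C\<close> only, so restricting changes
          nothing there.\<close>
        define G' where "G' = restrict G C"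
        have G'M: "G' \<in> M" unfolding G'_def M_def by (rule set_lipschitz_imp_nonexpansive[OF G(1)]) simp
        have close_eq: "set_close s C G' H = set_close s C G H" "set_close s C H G' = set_close s C H G" for s H
          by (auto simp: set_close_def G'_def)
        have dist_iff: "unif_dist C A B \<le> s \<longleftrightarrow> set_close s C A B" if "A \<in> M" "B \<in> M" for A B s
          using unif_dist_le_iff[OF assms(4,1)] that unfolding M_def by blast
        have "unif_dist C F G' \<le> e / 2" by (simp only: dist_iff[OF F G'M] close_eq G(2))
        then have "G' \<in> MS.mball F e" using F G'M e by simp
        moreover have "MS.mball G' \<delta> \<subseteq> S m"
        proof
          fix F' assume "F' \<in> MS.mball G' \<delta>"
          then have F': "F' \<in> M" "unif_dist C G' F' \<le> \<delta>" by auto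
          then have "set_close \<delta> C G F'" using dist_iff[OF G'M F'(1)] close_eq by simp
          then show "F' \<in> S m" using G(4) F'(1) by (simp add: S_def)
        qed
        then have "MS.mball G' \<delta> \<subseteq> X interior_of S m"
          by (intro interior_of_maximal) (simp_all add: X)
        moreover have "G' \<in> MS.mball G' \<delta>" using G'M G(3) by simp
        ultimately show ?thesis by blast
      qed
      then show "F \<in> X closure_of (X interior_of S m)"
        using F unfolding X MS.metric_closure_of by simp
    qed
  qed
  define \<F> where "\<F> = (\<Inter>m. S m)"
  have \<F>M: "\<F> \<subseteq> M" by (auto simp: \<F>_def S_def)
  have "nowhere_dense_in X (M - S m)" for m
  proof -
    have "X closure_of (M - S m) = M - X interior_of S m"
      using closure_of_complement[of X "S m"] topX by simp
    moreover have "X interior_of (M - X interior_of S m) = M - X closure_of (X interior_of S m)"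
      using interior_of_complement[of X "X interior_of S m"] topX by simp
    ultimately show ?thesis using dense[of m] topX by (auto simp: nowhere_dense_in_def)
  qed
  moreover have "M - \<F> = \<Union>(range (\<lambda>m. M - S m))" by (auto simp: \<F>_def)
  ultimately have "meagre_in X (M - \<F>)"
    unfolding meagre_in_def by (intro exI[of _ "range (\<lambda>m. M - S m)"]) auto
  then have "residual_in X \<F>" using \<F>M by (simp add: residual_in_def topX)
  moreover have "\<exists>x. is_regular_trajectory C F x0 x \<and> (\<exists>l\<in>C. l \<in> F l \<and> x \<longlonglongrightarrow> l)" if "F \<in> \<F>" for F
  proof (rule settled_imp_regular_convergent[OF _ assms(2,5)])
    show "F \<in> nonexpansive_maps C" using that \<F>M by (auto simp: M_def)
    show "settled C x0 (1 / real (Suc m)) F" for m using that by (auto simp: \<F>_def S_def)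
  qed
  ultimately show ?thesis using \<F>M unfolding X_def M_def by blast
qed

end
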